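(* Let $X$ be a Banach space and let $(A(t),D(A(t)))_{t\in\mathbb R}$, $(B(t),D(B(t)))_{t\in\mathbb R}$ be families of linear operators on $X$. Suppose that: (a) the non-autonomous Cauchy problem for the family $(A(t)+B(t))_{t\in\mathbb R}$ is well-posed; let $W=(W(t,s))_{t\ge s}$ be the evolution family solving it, and let its evolution semigroup $\mathcal W$ on $C_0(\mathbb R;X)$ be generated by the closure of $\mathcal C:=-\frac{d}{ds}+A(\cdot)+B(\cdot)$; (b) there are $M\ge 1$ and $\omega\in\mathbb R$ such that for every $r\in\mathbb R$ the operators $A(r)$ and $B(r)$ generate $C_0$-semigroups $(e^{tA(r)})_{t\ge0}$, $(e^{tB(r)})_{t\ge 0}$ on $X$ with $\|e^{tA(r)}\|\le Me^{\omega t}$ and $\|e^{tB(r)}\|\le Me^{\omega t}$ for all $t\ge0$, and moreover $$\sup_{s\in\mathbb R}\Bigl\|\prod_{p=n}^{1}\bigl(e^{\frac tn B(s-\frac{pt}{n})}e^{\frac tn A(s-\frac{pt}{n})}\bigr)\Bigr\|\le Me^{\omega t}\qquad\text{for all } t\ge 0,\ n\in\mathbb N;$$ (c) the maps $t\mapsto R(\lambda,A(t))x$ and $t\mapsto R(\lambda,B(t))x$ are continuous on $\mathbb R$ for all $\lambda>\omega$ and $x\in X$. Then for all $x\in X$ $$W(t,s)x=\lim_{n\to\infty}\prod_{p=0}^{n-1}\Bigl(e^{\frac{t-s}{n}B(s+\frac{p(t-s)}{n})}e^{\frac{t-s}{n}A(s+\frac{p(t-s)}{n})}\Bigr)x,$$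 locally uniformly in $s,t$ with $s\le t$.
   Context: Products are ordered: $\prod_{p=0}^{n-1}U_p:=U_{n-1}U_{n-2}\cdots U_1U_0$ and, with decreasing index, $\prod_{p=n}^{1}U_p:=U_1U_2\cdots U_n$. $R(\lambda,G)=(\lambda-G)^{-1}$. The sum $A(t)+B(t)$ has domain $D(A(t))\cap D(B(t))$. For a family $(G(t),D(G(t)))_{t\in\mathbb R}$ of linear operators on $X$, a classical solution of $(\mathrm{NCP})_{s,x}$: $u'(t)=G(t)u(t)$ $(t\ge s)$, $u(s)=x$, is a function $u\in C^1([s,\infty);X)$ with $u(t)\in D(G(t))$ and $u'(t)=G(t)u(t)$ for $t\ge s$, and $u(s)=x$. The problem is well-posed if: (i) for each $s$ the space $Y_s$ of all $y\in X$ such that $(\mathrm{NCP})_{s,y}$ has a classical solution is dense in $X$ (and contained in $D(G(s))$); (ii) for $y\in Y_s$ the solution $u_s(\cdot,y)$ is unique; (iii) if $s_n\to s$, $Y_{s_n}\ni y_n\to y\in Y_s$, then $\hat u_{s_n}(t,y_n)\to\hat u_s(t,y)$ uniformly for $t$ in compact subsets of $\mathbb R$, where $\hat u_r(t,y)=u_r(t,y)$ if $t\ge r$ and $=y$ if $t<r$; (iv) there are $M\ge1,\omega\in\mathbb R$ with $\|u_s(t,y)\|\le Me^{\omega(t-s)}\|y\|$ for all $y\in Y_s$, $t\ge s$. An (exponentially bounded) evolution family is a family $(U(t,s))_{t\ge s}$ in $\mathcal L(X)$ with $U(t,r)U(r,s)=U(t,s)$, $U(t,t)=I$ for $t\ge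 r\ge s$, $(t,s)\mapsto U(t,s)$ strongly continuous, and $\|U(t,s)\|\le Me^{\omega(t-s)}$ for some $M\ge 1$, $\omega\in\mathbb R$. It solves the problem if for every $s$ the set of $y\in X$ for which $t\mapsto U(t,s)y$ is a classical solution of $(\mathrm{NCP})_{s,y}$ is dense in $X$. Well-posedness is equivalent to the existence of a unique evolution family solving the problem; it satisfies $U(t,s)y=u_s(t,y)$ for $y\in Y_s$. $C_0(\mathbb R;X)$ is the space of continuous functions $\mathbb R\to X$ vanishing at infinity, with sup norm. The evolution semigroup of an evolution family $U$ is the $C_0$-semigroup $(\mathcal T(t)f)(s)=U(s,s-t)f(s-t)$ on $C_0(\mathbb R;X)$. The multiplication operator $A(\cdot)$ on $C_0(\mathbb R;X)$ has domain $D(A(\cdot))=\{f\in C_0(\mathbb R;X): f(s)\in D(A(s))\ \forall s,\ [s\mapsto A(s)f(s)]\in C_0(\mathbb R;X)\}$ and $(A(\cdot)f)(s)=A(s)f(s)$; likewise $B(\cdot)$. The operator $-\frac{d}{ds}$ has domain $\{f\in C^1(\mathbb R;X): f,f'\in C_0(\mathbb R;X)\}$, and $\mathcal C$ has domain $D(-\frac{d}{ds})\cap D(A(\cdot))\cap D(B(\cdot))$. *)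

theory Defs
  imports "HOL-Analysis.Analysis"
begin

section \<open>The Banach space of continuous functions on the line vanishing at infinity\<close>

definition C0 :: "(real \<Rightarrow> 'a::real_normed_vector) set" where
  "C0 = {f. continuous_on UNIV f \<and> (f \<longlongrightarrow> 0) at_infinity}"

typedef (overloaded) 'a c0 = "C0 :: (real \<Rightarrow> 'a::real_normed_vector) set"
  morphisms apply_c0 Abs_c0
  by (rule exI[of _ "\<lambda>_. 0"]) (simp add: C0_def)

lemma c0_eqI: "(\<And>s. apply_c0 f s = apply_c0 g s) \<Longrightarrow> f = g"
  by (simp add: apply_c0_inject[symmetric] fun_eq_iff)

lemma apply_Abs_c0: "f \<in> C0 \<Longrightarrow> apply_c0 (Abs_c0 f) = f"
  by (rule Abs_c0_inverse)

lemma C0_bounded: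
  fixes f :: "real \<Rightarrow> 'a::real_normed_vector"
  assumes "f \<in> C0"
  shows "bounded (range f)"
proof -
  have cont: "continuous_on UNIV f" and lim: "(f \<longlongrightarrow> 0) at_infinity"
    using assms by (auto simp: C0_def)
  from tendstoD[OF lim zero_less_one]
  obtain b where b: "\<And>s. b \<le> norm s \<Longrightarrow> dist (f s) 0 < 1"
    by (auto simp: eventually_at_infinity)
  have "compact (f ` cball 0 b)"
    by (intro compact_continuous_image continuous_on_subset[OF cont]) auto
  then have "bounded (f ` cball 0 b \<union> cball 0 1)"
    by (simp add: compact_imp_bounded)
  moreover have "range f \<subseteq> f ` cball 0 b \<union> cball 0 1"
  proof safe
    fix s assume "f s \<notin> cball 0 1"
    then have "\<not> b \<le> norm s" using b[of s] by (auto simp: dist_commute)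
    then show "f s \<in> f ` cball 0 b" by auto
  qed
  ultimately show ?thesis by (rule bounded_subset)
qed

lemma C0_zero: "(\<lambda>_. 0) \<in> C0"
  and C0_add: "f \<in> C0 \<Longrightarrow> g \<in> C0 \<Longrightarrow> (\<lambda>s. f s + g s) \<in> C0"
  and C0_diff: "f \<in> C0 \<Longrightarrow> g \<in> C0 \<Longrightarrow> (\<lambda>s. f s - g s) \<in> C0"
  and C0_minus: "f \<in> C0 \<Longrightarrow> (\<lambda>s. - f s) \<in> C0"
  by (auto simp: C0_def intro!: continuous_intros tendsto_eq_intros)

lemma C0_scaleR: "f \<in> C0 \<Longrightarrow> (\<lambda>s. c *\<^sub>R f s) \<in> C0"
  unfolding C0_def
  by (auto intro!: continuous_intros tendsto_eq_intros)

instantiation c0 :: (real_normed_vector) real_vector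
begin

definition zero_c0 :: "'a c0" where "0 = Abs_c0 (\<lambda>_. 0)"
definition plus_c0 :: "'a c0 \<Rightarrow> 'a c0 \<Rightarrow> 'a c0" where
  "f + g = Abs_c0 (\<lambda>s. apply_c0 f s + apply_c0 g s)"
definition minus_c0 :: "'a c0 \<Rightarrow> 'a c0 \<Rightarrow> 'a c0" where
  "f - g = Abs_c0 (\<lambda>s. apply_c0 f s - apply_c0 g s)"
definition uminus_c0 :: "'a c0 \<Rightarrow> 'a c0" where
  "- f = Abs_c0 (\<lambda>s. - apply_c0 f s)"
definition scaleR_c0 :: "real \<Rightarrow> 'a c0 \<Rightarrow> 'a c0" where
  "c *\<^sub>R f = Abs_c0 (\<lambda>s. c *\<^sub>R apply_c0 f s)"
lemma apply_c0_simps [simp]: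
  "apply_c0 (0 :: 'a c0) = (\<lambda>_. 0)"
  "apply_c0 (f + g) = (\<lambda>s. apply_c0 f s + apply_c0 g s)"
  "apply_c0 (f - g) = (\<lambda>s. apply_c0 f s - apply_c0 g s)"
  "apply_c0 (- f) = (\<lambda>s. - apply_c0 f s)"
  "apply_c0 (c *\<^sub>R f) = (\<lambda>s. c *\<^sub>R apply_c0 f s)"
  by (simp_all add: zero_c0_def plus_c0_def minus_c0_def uminus_c0_def scaleR_c0_def apply_Abs_c0
      C0_zero C0_add C0_diff C0_minus C0_scaleR apply_c0)

instance
proof
  fix f g h :: "'a c0" and a b :: real
  show "f + g + h = f + (g + h)" "f + g = g + f" "0 + f = f" "- f + f = 0" "f - g = f + - g"
    "a *\<^sub>R (f + g) = a *\<^sub>R f + a *\<^sub>R g" "(a + b) *\<^sub>R f = a *\<^sub>R f + b *\<^sub>R f"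
    "a *\<^sub>R b *\<^sub>R f = (a * b) *\<^sub>R f" "1 *\<^sub>R f = f"
    by (auto intro!: c0_eqI simp: algebra_simps)
qed

end

instantiation c0 :: (real_normed_vector) real_normed_vector
begin

definition norm_c0 :: "'a c0 \<Rightarrow> real" where
  "norm f = (SUP s. norm (apply_c0 f s))"
definition sgn_c0 :: "'a c0 \<Rightarrow> 'a c0" where
  "sgn (f :: 'a c0) = f /\<^sub>R norm f"
definition dist_c0 :: "'a c0 \<Rightarrow> 'a c0 \<Rightarrow> real" where
  "dist (f :: 'a c0) g = norm (f - g)"
definition uniformity_c0 :: "('a c0 \<times> 'a c0) filter" where
  "uniformity_c0 = (INF e\<in>{0<..}. principal {(x :: 'a c0, y). dist x y < e})"
definition open_c0 :: "'a c0 set \<Rightarrow> bool" where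
  "open_c0 (S :: 'a c0 set) = (\<forall>x\<in>S. \<forall>\<^sub>F (x', y) in uniformity. x' = x \<longrightarrow> y \<in> S)"

lemma norm_apply_c0_le: "norm (apply_c0 f s) \<le> norm f"
proof -
  have "bdd_above (range (\<lambda>s. norm (apply_c0 f s)))"
    using C0_bounded[OF apply_c0[of f]]
    by (auto simp: bounded_iff bdd_above_def)
  then show ?thesis unfolding norm_c0_def by (intro cSUP_upper) auto
qed

lemma norm_c0_leI: "(\<And>s. norm (apply_c0 f s) \<le> b) \<Longrightarrow> norm f \<le> b"
  unfolding norm_c0_def by (intro cSUP_least) auto

instance
proof
  fix f g :: "'a c0" and a :: real
  show "dist f g = norm (f - g)" by (rule dist_c0_def)
  show "sgn f = f /\<^sub>R norm f" by (rule sgn_c0_def)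
  show "(norm f = 0) = (f = 0)"
  proof
    assume "norm f = 0"
    then show "f = 0" using norm_apply_c0_le[of f] by (intro c0_eqI) simp
  qed (simp add: norm_c0_def)
  show "norm (f + g) \<le> norm f + norm g"
    by (rule norm_c0_leI) (simp add: norm_triangle_le add_mono norm_apply_c0_le)
  have le: "norm (c *\<^sub>R k) \<le> \<bar>c\<bar> * norm k" for c and k :: "'a c0"
    by (rule norm_c0_leI) (simp add: mult_left_mono norm_apply_c0_le)
  show "norm (a *\<^sub>R f) = \<bar>a\<bar> * norm f"
  proof (cases "a = 0")
    case True
    then show ?thesis
      by (simp add: norm_c0_def)
  next
    case False
    have "inverse a *\<^sub>R a *\<^sub>R f = f"
      using False by (intro c0_eqI) simp
    then have "norm f \<le> \<bar>inverse a\<bar> * norm (a *\<^sub>R f)"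
      using le[of "inverse a" "a *\<^sub>R f"] by simp
    then have "\<bar>a\<bar> * norm f \<le> norm (a *\<^sub>R f)"
      using False by (simp add: field_simps)
    then show ?thesis using le[of a f] by simp
  qed
qed (rule uniformity_c0_def open_c0_def)+

end

declare [[coercion "apply_c0 :: 'a::real_normed_vector c0 \<Rightarrow> real \<Rightarrow> 'a"]]

lemma uniform_limit_c0:
  fixes f :: "nat \<Rightarrow> 'a::real_normed_vector c0"
  assumes "uniform_limit UNIV (\<lambda>n. apply_c0 (f n)) l sequentially"
  shows "l \<in> C0" and "f \<longlonglongrightarrow> Abs_c0 l"
proof -
  have "continuous_on UNIV l"
    using apply_c0[of "f _"]
    by (intro uniform_limit_theorem[OF _ assms] always_eventually allI) (simp_all add: C0_def)
  moreover have "(l \<longlongrightarrow> 0) at_infinity"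
  proof (rule tendstoI)
    fix e :: real assume "e > 0"
    then have "\<forall>\<^sub>F n in sequentially. \<forall>s\<in>UNIV. dist (f n s) (l s) < e / 2"
      by (intro uniform_limitD[OF assms]) simp
    then obtain n where n: "\<And>s. dist (f n s) (l s) < e / 2"
      by (auto simp: eventually_sequentially)
    have "(f n \<longlongrightarrow> 0) at_infinity" using apply_c0[of "f n"] by (simp add: C0_def)
    then have "\<forall>\<^sub>F s in at_infinity. dist (f n s) 0 < e / 2"
      using \<open>e > 0\<close> by (intro tendstoD) auto
    then show "\<forall>\<^sub>F s in at_infinity. dist (l s) 0 < e"
      by eventually_elim (metis dist_commute dist_triangle_half_l n)
  qed
  ultimately show l: "l \<in> C0" by (simp add: C0_def)
  show "f \<longlonglongrightarrow> Abs_c0 l"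
  proof (rule tendstoI)
    fix e :: real assume "e > 0"
    then have "\<forall>\<^sub>F n in sequentially. \<forall>s\<in>UNIV. dist (f n s) (l s) < e / 2"
      by (intro uniform_limitD[OF assms]) simp
    then show "\<forall>\<^sub>F n in sequentially. dist (f n) (Abs_c0 l) < e"
    proof eventually_elim
      case (elim n)
      then have "norm (f n - Abs_c0 l) \<le> e / 2"
        by (intro norm_c0_leI) (auto simp: apply_Abs_c0[OF l] dist_norm less_imp_le)
      then show ?case using \<open>e > 0\<close> by (simp add: dist_norm)
    qed
  qed
qed

instance c0 :: (banach) banach
proof
  fix f :: "nat \<Rightarrow> 'a c0"
  assume "Cauchy f"
  have "uniformly_Cauchy_on UNIV (\<lambda>n. apply_c0 (f n))"
  proof (rule uniformly_Cauchy_onI)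
    fix e :: real assume "e > 0"
    then obtain M where M: "\<And>m n. m \<ge> M \<Longrightarrow> n \<ge> M \<Longrightarrow> dist (f m) (f n) < e"
      using \<open>Cauchy f\<close> by (meson metric_CauchyD)
    have "dist (f m s) (f n s) \<le> dist (f m) (f n)" for m n s
      using norm_apply_c0_le[of "f m - f n" s] by (simp add: dist_norm)
    then show "\<exists>M. \<forall>s\<in>UNIV. \<forall>m\<ge>M. \<forall>n\<ge>M. dist (f m s) (f n s) < e"
      using M by (intro exI[of _ M] ballI allI impI) (rule le_less_trans)
  qed
  then have "uniformly_convergent_on UNIV (\<lambda>n. apply_c0 (f n))"
    by (rule Cauchy_uniformly_convergent)
  then show "convergent f"
    using uniform_limit_c0(2) by (auto simp: uniformly_convergent_on_def convergent_def)
qed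

section \<open>Linear operators and strongly continuous semigroups\<close>

text \<open>A (possibly unbounded) linear operator is given by its domain \<open>D\<close> together with a function
  whose values outside \<open>D\<close> are irrelevant.\<close>

definition linear_operator :: "'a::real_vector set \<Rightarrow> ('a \<Rightarrow> 'a) \<Rightarrow> bool" where
  "linear_operator D A \<longleftrightarrow> subspace D \<and>
     (\<forall>x\<in>D. \<forall>y\<in>D. A (x + y) = A x + A y) \<and> (\<forall>c. \<forall>x\<in>D. A (c *\<^sub>R x) = c *\<^sub>R A x)"

definition op_graph :: "'a set \<Rightarrow> ('a \<Rightarrow> 'a) \<Rightarrow> ('a \<times> 'a) set" where
  "op_graph D A = {(x, A x) | x. x \<in> D}"

text \<open>\<open>R(\<lambda>,A) = (\<lambda> - A)\<inverse>\<close>; meaningful when \<open>\<lambda> - A\<close> maps \<open>D\<close> bijectively onto the space.\<close>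

definition resolvent :: "real \<Rightarrow> 'a::real_vector set \<Rightarrow> ('a \<Rightarrow> 'a) \<Rightarrow> 'a \<Rightarrow> 'a" where
  "resolvent l D A = the_inv_into D (\<lambda>y. l *\<^sub>R y - A y)"

text \<open>Semigroups are indexed by \<open>real\<close>; only the values at nonnegative times are relevant.\<close>

definition C0_semigroup :: "(real \<Rightarrow> 'a::real_normed_vector \<Rightarrow>\<^sub>L 'a) \<Rightarrow> bool" where
  "C0_semigroup T \<longleftrightarrow> T 0 = id_blinfun \<and>
     (\<forall>t\<ge>0. \<forall>s\<ge>0. T (t + s) = T t o\<^sub>L T s) \<and>
     (\<forall>x. continuous_on {0..} (\<lambda>t. T t x))"

definition generator_graph :: "(real \<Rightarrow> 'a::real_normed_vector \<Rightarrow>\<^sub>L 'a) \<Rightarrow> ('a \<times> 'a) set" where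
  "generator_graph T = {(x, y). ((\<lambda>h. (T h x - x) /\<^sub>R h) \<longlongrightarrow> y) (at_right 0)}"

definition generates ::
  "'a::real_normed_vector set \<Rightarrow> ('a \<Rightarrow> 'a) \<Rightarrow> (real \<Rightarrow> 'a \<Rightarrow>\<^sub>L 'a) \<Rightarrow> bool" where
  "generates D A T \<longleftrightarrow> C0_semigroup T \<and> op_graph D A = generator_graph T"

section \<open>Nonautonomous Cauchy problems and evolution families\<close>

definition classical_solution ::
  "(real \<Rightarrow> 'a::real_normed_vector set) \<Rightarrow> (real \<Rightarrow> 'a \<Rightarrow> 'a) \<Rightarrow> real \<Rightarrow> 'a \<Rightarrow> (real \<Rightarrow> 'a) \<Rightarrow> bool" where
  "classical_solution D G s x u \<longleftrightarrow>
     (\<exists>u'. continuous_on {s..} u' \<and>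
        (\<forall>t\<ge>s. (u has_vector_derivative u' t) (at t within {s..}) \<and>
                u t \<in> D t \<and> u' t = G t (u t))) \<and>
     u s = x"

definition solvable_data ::
  "(real \<Rightarrow> 'a::real_normed_vector set) \<Rightarrow> (real \<Rightarrow> 'a \<Rightarrow> 'a) \<Rightarrow> real \<Rightarrow> 'a set" where
  "solvable_data D G s = {y. \<exists>u. classical_solution D G s y u}"

definition extend_left :: "real \<Rightarrow> 'a \<Rightarrow> (real \<Rightarrow> 'a) \<Rightarrow> real \<Rightarrow> 'a" where
  "extend_left s y u t = (if s \<le> t then u t else y)"

definition well_posed ::
  "(real \<Rightarrow> 'a::real_normed_vector set) \<Rightarrow> (real \<Rightarrow> 'a \<Rightarrow> 'a) \<Rightarrow> bool" where
  "well_posed D G \<longleftrightarrow>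
     (\<forall>s. closure (solvable_data D G s) = UNIV \<and> solvable_data D G s \<subseteq> D s) \<and>
     (\<forall>s y u v. classical_solution D G s y u \<longrightarrow> classical_solution D G s y v \<longrightarrow>
        (\<forall>t\<ge>s. u t = v t)) \<and>
     (\<forall>\<sigma> s \<eta> y \<upsilon> u. \<sigma> \<longlonglongrightarrow> s \<longrightarrow> \<eta> \<longlonglongrightarrow> y \<longrightarrow>
        (\<forall>n. classical_solution D G (\<sigma> n) (\<eta> n) (\<upsilon> n)) \<longrightarrow> classical_solution D G s y u \<longrightarrow>
        (\<forall>K. compact K \<longrightarrow>
           uniform_limit K (\<lambda>n. extend_left (\<sigma> n) (\<eta> n) (\<upsilon> n)) (extend_left s y u) sequentially)) \<and>
     (\<exists>M \<omega>. 1 \<le> M \<and> (\<forall>s y u. classical_solution D G s y u \<longrightarrow>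
        (\<forall>t\<ge>s. norm (u t) \<le> M * exp (\<omega> * (t - s)) * norm y)))"

text \<open>Only the values \<open>U t s\<close> with \<open>s \<le> t\<close> are relevant.\<close>

definition evolution_family :: "(real \<Rightarrow> real \<Rightarrow> 'a::real_normed_vector \<Rightarrow>\<^sub>L 'a) \<Rightarrow> bool" where
  "evolution_family U \<longleftrightarrow>
     (\<forall>t r s. s \<le> r \<and> r \<le> t \<longrightarrow> U t r o\<^sub>L U r s = U t s) \<and>
     (\<forall>t. U t t = id_blinfun) \<and>
     (\<forall>x. continuous_on {(t, s). s \<le> t} (\<lambda>(t, s). U t s x)) \<and>
     (\<exists>M \<omega>. 1 \<le> M \<and> (\<forall>t s. s \<le> t \<longrightarrow> norm (U t s) \<le> M * exp (\<omega> * (t - s))))"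

definition solves_NCP :: "(real \<Rightarrow> real \<Rightarrow> 'a::real_normed_vector \<Rightarrow>\<^sub>L 'a) \<Rightarrow>
    (real \<Rightarrow> 'a set) \<Rightarrow> (real \<Rightarrow> 'a \<Rightarrow> 'a) \<Rightarrow> bool" where
  "solves_NCP U D G \<longleftrightarrow>
     (\<forall>s. closure {y. classical_solution D G s y (\<lambda>t. U t s y)} = UNIV)"

section \<open>Evolution semigroups and operators on the function space\<close>

definition evolution_semigroup ::
  "(real \<Rightarrow> real \<Rightarrow> 'a::real_normed_vector \<Rightarrow>\<^sub>L 'a) \<Rightarrow> real \<Rightarrow> 'a c0 \<Rightarrow>\<^sub>L 'a c0" where
  "evolution_semigroup U t = Blinfun (\<lambda>f. Abs_c0 (\<lambda>s. U s (s - t) (apply_c0 f (s - t))))"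

lemma evolution_semigroup_C0:
  fixes U :: "real \<Rightarrow> real \<Rightarrow> 'a::real_normed_vector \<Rightarrow>\<^sub>L 'a"
  assumes U: "evolution_family U" and t: "0 \<le> t" and f: "f \<in> C0"
  shows "(\<lambda>s. U s (s - t) (f (s - t))) \<in> C0"
proof -
  obtain M w where "1 \<le> M" and bd: "\<And>t s. s \<le> t \<Longrightarrow> norm (U t s) \<le> M * exp (w * (t - s))"
    using U unfolding evolution_family_def by blast
  define K where "K = M * exp (w * t)"
  have K: "norm (U s (s - t)) \<le> K" for s
    using bd[of "s - t" s] t by (simp add: K_def)
  have est: "norm (U s (s - t) z) \<le> K * norm z" for s z
    by (rule order_trans[OF norm_blinfun mult_right_mono[OF K norm_ge_zero]])
  have fc: "continuous_on UNIV f" and fl: "(f \<longlongrightarrow> 0) at_infinity"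
    using f by (auto simp: C0_def)
  have Uc: "continuous_on UNIV (\<lambda>s. U s (s - t) x)" for x
  proof -
    have 1: "continuous_on {(t, s). s \<le> t} (\<lambda>(t, s). U t s x)"
      using U unfolding evolution_family_def by blast
    have 2: "continuous_on UNIV (\<lambda>s. (s, s - t))"
      by (intro continuous_on_Pair continuous_on_diff continuous_on_id continuous_on_const)
    have 3: "range (\<lambda>s. (s, s - t)) \<subseteq> {(t, s). s \<le> t}"
      using t by auto
    from continuous_on_compose2[OF 1 2 3] show ?thesis
      by simp
  qed
  have "isCont (\<lambda>s. U s (s - t) (f (s - t))) a" for a
  proof -
    have "((\<lambda>s. f (s - t)) \<longlongrightarrow> f (a - t)) (at a)"
      using fc
      by (intro isCont_tendsto_compose[where g = f, OF _ tendsto_diff[OF tendsto_ident_at tendsto_const]])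
        (simp add: continuous_on_eq_continuous_at)
    then have "((\<lambda>s. K * norm (f (s - t) - f (a - t))) \<longlongrightarrow> K * norm (f (a - t) - f (a - t))) (at a)"
      by (intro tendsto_mult tendsto_norm tendsto_diff tendsto_const)
    then have "((\<lambda>s. K * norm (f (s - t) - f (a - t))) \<longlongrightarrow> 0) (at a)"
      by simp
    then have 1: "((\<lambda>s. U s (s - t) (f (s - t) - f (a - t))) \<longlongrightarrow> 0) (at a)"
      by (rule Lim_null_comparison[OF always_eventually, rotated]) (rule allI, rule est)
    have 2: "((\<lambda>s. U s (s - t) (f (a - t))) \<longlongrightarrow> U a (a - t) (f (a - t))) (at a)"
      using Uc[of "f (a - t)"] unfolding continuous_on_def by simp
    from tendsto_add[OF 1 2] show ?thesis
      by (simp add: isCont_def blinfun.diff_right)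
  qed
  moreover have "((\<lambda>s. U s (s - t) (f (s - t))) \<longlongrightarrow> 0) at_infinity"
  proof -
    have "filterlim (\<lambda>s. s - t) at_infinity at_infinity"
      using tendsto_add_filterlim_at_infinity'[OF filterlim_ident tendsto_const[of "- t"]]
      by simp
    then have "((\<lambda>s. f (s - t)) \<longlongrightarrow> 0) at_infinity"
      by (rule filterlim_compose[OF fl])
    then have "((\<lambda>s. K * norm (f (s - t))) \<longlongrightarrow> 0) at_infinity"
      by (intro tendsto_mult_right_zero tendsto_norm_zero)
    then show ?thesis
      by (rule Lim_null_comparison[OF always_eventually, rotated]) (rule allI, rule est)
  qed
  ultimately show ?thesis by (simp add: C0_def continuous_on_eq_continuous_at)
qed

lemma evolution_semigroup_apply:
  fixes U :: "real \<Rightarrow> real \<Rightarrow> 'a::real_normed_vector \<Rightarrow>\<^sub>L 'a"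
  assumes U: "evolution_family U" and t: "0 \<le> t"
  shows "evolution_semigroup U t f s = U s (s - t) (f (s - t))"
proof -
  obtain M w where "1 \<le> M" and bd: "\<And>t s. s \<le> t \<Longrightarrow> norm (U t s) \<le> M * exp (w * (t - s))"
    using U unfolding evolution_family_def by blast
  have est: "norm (U s (s - t) (f (s - t))) \<le> norm f * (M * exp (w * t))" for s and f :: "'a c0"
  proof -
    have "norm (U s (s - t) (f (s - t))) \<le> norm (U s (s - t)) * norm (f (s - t))"
      by (rule norm_blinfun)
    also have "\<dots> \<le> (M * exp (w * t)) * norm f"
      using bd[of "s - t" s] t \<open>1 \<le> M\<close> by (intro mult_mono norm_apply_c0_le) auto
    finally show ?thesis by (simp add: mult.commute)
  qed
  note ap = apply_Abs_c0[OF evolution_semigroup_C0[OF U t apply_c0]]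
  have "bounded_linear (\<lambda>f. Abs_c0 (\<lambda>s. U s (s - t) (apply_c0 f (s - t))))"
  proof (rule bounded_linear_intro)
    show "norm (Abs_c0 (\<lambda>s. U s (s - t) (apply_c0 f (s - t)))) \<le> norm f * (M * exp (w * t))" for f
      by (rule norm_c0_leI) (simp add: ap est)
    show "Abs_c0 (\<lambda>s. U s (s - t) (apply_c0 (f + g) (s - t))) =
      Abs_c0 (\<lambda>s. U s (s - t) (apply_c0 f (s - t))) + Abs_c0 (\<lambda>s. U s (s - t) (apply_c0 g (s - t)))" for f g
      by (rule c0_eqI) (simp only: ap[of "f + g"], simp add: ap blinfun.add_right)
    show "Abs_c0 (\<lambda>s. U s (s - t) (apply_c0 (c *\<^sub>R f) (s - t))) =
      c *\<^sub>R Abs_c0 (\<lambda>s. U s (s - t) (apply_c0 f (s - t)))" for c f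
      by (rule c0_eqI) (simp only: ap[of "c *\<^sub>R f"], simp add: ap blinfun.scaleR_right)
  qed
  then show ?thesis
    by (simp add: evolution_semigroup_def bounded_linear_Blinfun_apply ap)
qed

definition mult_dom ::
  "(real \<Rightarrow> 'a::real_normed_vector set) \<Rightarrow> (real \<Rightarrow> 'a \<Rightarrow> 'a) \<Rightarrow> 'a c0 set" where
  "mult_dom D A = {f :: 'a c0. (\<forall>s. f s \<in> D s) \<and> (\<lambda>s. A s (f s)) \<in> C0}"

definition mult_op :: "(real \<Rightarrow> 'a::real_normed_vector \<Rightarrow> 'a) \<Rightarrow> 'a c0 \<Rightarrow> 'a c0" where
  "mult_op A f = Abs_c0 (\<lambda>s. A s (f s))"

text \<open>Continuity of the derivative is part of its membership in \<open>C0\<close>.\<close>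

definition deriv_dom :: "'a::real_normed_vector c0 set" where
  "deriv_dom = {f :: 'a c0. (\<forall>s. apply_c0 f differentiable at s) \<and> (\<lambda>s. vector_derivative f (at s)) \<in> C0}"

definition deriv_op :: "'a::real_normed_vector c0 \<Rightarrow> 'a c0" where
  "deriv_op f = Abs_c0 (\<lambda>s. vector_derivative f (at s))"

section \<open>Ordered products\<close>

text \<open>\<open>prod_increasing V n = V (n - 1) \<circ> \<dots> \<circ> V 1 \<circ> V 0\<close>\<close>

primrec prod_increasing :: "(nat \<Rightarrow> 'a::real_normed_vector \<Rightarrow>\<^sub>L 'a) \<Rightarrow> nat \<Rightarrow> 'a \<Rightarrow>\<^sub>L 'a" where
  "prod_increasing V 0 = id_blinfun"
| "prod_increasing V (Suc n) = V n o\<^sub>L prod_increasing V n"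

text \<open>\<open>prod_decreasing V n = V 1 \<circ> V 2 \<circ> \<dots> \<circ> V n\<close>\<close>

primrec prod_decreasing :: "(nat \<Rightarrow> 'a::real_normed_vector \<Rightarrow>\<^sub>L 'a) \<Rightarrow> nat \<Rightarrow> 'a \<Rightarrow>\<^sub>L 'a" where
  "prod_decreasing V 0 = id_blinfun"
| "prod_decreasing V (Suc n) = prod_decreasing V n o\<^sub>L V (Suc n)"

end

theory Submission
  imports Defs
begin

text \<open>The step operators \<open>(V(h) f)(s) = e\<^bsup>hB(s-h)\<^esup> e\<^bsup>hA(s-h)\<^esup> f(s - h)\<close> on \<open>C\<^sub>0(\<real>; X)\<close> are products
  of the translation semigroup and of the multiplication semigroups generated by \<open>B(\<cdot>)\<close> and \<open>A(\<cdot>)\<close>, so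
  their difference quotients converge to \<open>\<C>\<close> on the core, and their powers are the ordered products whose
  stability is assumed: the claim is Chernoff's product formula for the evolution semigroup of \<open>W\<close>,
  and cutting off constants turns convergence in \<open>C\<^sub>0\<close> into locally uniform convergence.

  Since the limit semigroup \<open>T\<close> is given, Chernoff's formula needs no resolvent estimates. It is
  proved by telescoping along averages of points that approximate the orbit of \<open>T\<close> together with their
  difference quotients; no invariance of the core is required. For step operators depending on a
  parameter the same argument yields the Trotter-Kato theorem, by which strong continuity of the
  resolvents of \<open>A(r)\<close> implies strong continuity of \<open>r \<mapsto> e\<^bsup>tA(r)\<^esup>\<close>, so that the multiplication
  semigroups act on \<open>C\<^sub>0(\<real>; X)\<close>.\<close>

section \<open>Product filters and uniform limits\<close>

lemma eventually_prod_principal: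
  "(\<forall>\<^sub>F (i, s) in F \<times>\<^sub>F principal S. P i s) \<longleftrightarrow> (\<forall>\<^sub>F i in F. \<forall>s\<in>S. P i s)"
proof
  assume "\<forall>\<^sub>F (i, s) in F \<times>\<^sub>F principal S. P i s"
  then obtain Pf where "eventually Pf F" "\<And>i s. Pf i \<Longrightarrow> s \<in> S \<Longrightarrow> P i s"
    unfolding eventually_prod_filter eventually_principal by auto
  then show "\<forall>\<^sub>F i in F. \<forall>s\<in>S. P i s" by (auto elim: eventually_mono)
next
  assume "\<forall>\<^sub>F i in F. \<forall>s\<in>S. P i s"
  then show "\<forall>\<^sub>F (i, s) in F \<times>\<^sub>F principal S. P i s"
    unfolding eventually_prod_filter eventually_principal
    by (intro exI[of _ "\<lambda>i. \<forall>s\<in>S. P i s"] exI[of _ "\<lambda>s. s \<in> S"]) simp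
qed

lemma uniform_limit_iff_tendsto_prod_principal:
  fixes f :: "'i \<Rightarrow> 'b \<Rightarrow> 'a::real_normed_vector"
  shows "uniform_limit S f l F \<longleftrightarrow> ((\<lambda>(i, s). f i s - l s) \<longlongrightarrow> 0) (F \<times>\<^sub>F principal S)"
  unfolding uniform_limit_iff tendsto_iff dist_norm eventually_prod_principal[symmetric]
  by (simp add: case_prod_beta')

lemma tendsto_compose_snd_iff:
  assumes "A \<noteq> bot"
  shows "((\<lambda>p. f (snd p)) \<longlongrightarrow> l) (A \<times>\<^sub>F B) \<longleftrightarrow> (f \<longlongrightarrow> l) B"
  unfolding tendsto_def by (subst eventually_prod2[OF assms, unfolded case_prod_beta']) (rule refl)

lemma eventually_ball_compact:
  assumes "compact C" and "\<And>s. s \<in> C \<Longrightarrow> \<forall>\<^sub>F (i, r) in F \<times>\<^sub>F nhds s. P i r"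
  shows "\<forall>\<^sub>F i in F. \<forall>r\<in>C. P i r"
proof -
  have "\<exists>Q U. eventually Q F \<and> open U \<and> s \<in> U \<and> (\<forall>i r. Q i \<longrightarrow> r \<in> U \<longrightarrow> P i r)" if "s \<in> C" for s
    using assms(2)[OF that] unfolding eventually_prod_filter eventually_nhds by fastforce
  then obtain Q U where QU: "\<And>s. s \<in> C \<Longrightarrow> eventually (Q s) F" "\<And>s. s \<in> C \<Longrightarrow> open (U s)"
    "\<And>s. s \<in> C \<Longrightarrow> s \<in> U s" "\<And>s i r. s \<in> C \<Longrightarrow> Q s i \<Longrightarrow> r \<in> U s \<Longrightarrow> P i r"
    by metis
  obtain C' where C': "C' \<subseteq> C" "finite C'" "C \<subseteq> (\<Union>s\<in>C'. U s)"
    by (rule compactE_image[OF assms(1), of C U]) (use QU in auto)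
  then have "\<forall>\<^sub>F i in F. \<forall>s\<in>C'. Q s i"
    using QU(1) by (intro eventually_ball_finite) auto
  then show ?thesis
    by eventually_elim (use C' QU(4) in blast)
qed

lemma uniform_limit_UNIV_zeroI:
  fixes \<Phi> :: "'i \<Rightarrow> 'b::{real_normed_vector, heine_borel} \<Rightarrow> 'a::real_normed_vector"
  assumes local: "\<And>s. ((\<lambda>(i, r). \<Phi> i r) \<longlongrightarrow> 0) (F \<times>\<^sub>F nhds s)"
    and infinity: "((\<lambda>(i, r). \<Phi> i r) \<longlongrightarrow> 0) (F \<times>\<^sub>F at_infinity)"
  shows "uniform_limit UNIV \<Phi> (\<lambda>_. 0) F"
proof (rule uniform_limitI)
  fix e :: real assume e: "0 < e"
  obtain Q R where Q: "eventually Q F" and R: "\<And>i r. Q i \<Longrightarrow> R \<le> norm r \<Longrightarrow> dist (\<Phi> i r) 0 < e"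
    using tendstoD[OF infinity e]
    unfolding eventually_prod_filter eventually_at_infinity prod.case by blast
  have "\<forall>\<^sub>F i in F. \<forall>r\<in>cball 0 R. dist (\<Phi> i r) 0 < e"
    using tendstoD[OF local e] by (intro eventually_ball_compact) (simp_all add: case_prod_beta')
  with Q show "\<forall>\<^sub>F i in F. \<forall>r\<in>UNIV. dist (\<Phi> i r) 0 < e"
  proof eventually_elim
    case (elim i)
    then show ?case using R[of i] by (metis dist_0_norm linear mem_cball)
  qed
qed

lemma filterlim_time_step:
  "filterlim (\<lambda>(n, t). t / real n) (at_right 0) (sequentially \<times>\<^sub>F principal {0<..\<tau>})"
proof (rule tendsto_imp_filterlim_at_right)
  let ?F = "sequentially \<times>\<^sub>F principal {0<..\<tau>}"
  have "\<forall>\<^sub>F (n, t) in ?F. 0 < n \<and> t \<in> {0<..\<tau>}"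
    unfolding eventually_prod_principal using eventually_gt_at_top[of "0::nat"] by eventually_elim simp
  then have F: "\<forall>\<^sub>F p in ?F. 0 < fst p \<and> snd p \<in> {0<..\<tau>}"
    by (simp add: case_prod_beta')
  then have "\<forall>\<^sub>F p in ?F. norm (case p of (n, t) \<Rightarrow> t / real n) \<le> \<tau> / real (fst p)"
    by eventually_elim (auto simp: divide_right_mono)
  then show "((\<lambda>(n, t). t / real n) \<longlongrightarrow> 0) ?F"
    by (rule Lim_null_comparison) (rule filterlim_compose[OF lim_const_over_n filterlim_fst])
  show "\<forall>\<^sub>F p in ?F. 0 < (case p of (n, t) \<Rightarrow> t / real n)"
    using F by eventually_elim auto
qed

section \<open>Strong convergence of equibounded operators\<close>

lemma tendsto_blinfun_apply_equibounded:
  fixes L :: "'i \<Rightarrow> 'a::real_normed_vector \<Rightarrow>\<^sub>L 'b::real_normed_vector"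
  assumes bound: "\<forall>\<^sub>F i in F. norm (L i) \<le> K"
    and pointwise: "((\<lambda>i. L i x) \<longlongrightarrow> y) F" and argument: "(u \<longlongrightarrow> x) F"
  shows "((\<lambda>i. L i (u i)) \<longlongrightarrow> y) F"
proof -
  have "((\<lambda>i. K * norm (u i - x)) \<longlongrightarrow> K * norm (x - x)) F"
    by (intro tendsto_intros argument)
  then have lim: "((\<lambda>i. K * norm (u i - x)) \<longlongrightarrow> 0) F" by simp
  have "\<forall>\<^sub>F i in F. norm (L i (u i - x)) \<le> K * norm (u i - x)"
    using bound
    by eventually_elim (rule order_trans[OF norm_blinfun mult_right_mono[OF _ norm_ge_zero]])
  then have "((\<lambda>i. L i (u i - x)) \<longlongrightarrow> 0) F"
    by (rule Lim_null_comparison[OF _ lim])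
  from tendsto_add[OF this pointwise] show ?thesis by (simp add: blinfun.diff_right)
qed

lemma strong_tendsto_zero_if_dense:
  fixes L :: "'i \<Rightarrow> 'a::real_normed_vector \<Rightarrow>\<^sub>L 'b::real_normed_vector"
  assumes bound: "\<forall>\<^sub>F i in F. norm (L i) \<le> K"
    and dense: "closure D = UNIV" and on_dense: "\<And>z. z \<in> D \<Longrightarrow> ((\<lambda>i. L i z) \<longlongrightarrow> 0) F"
  shows "((\<lambda>i. L i x) \<longlongrightarrow> 0) F"
proof (rule tendstoI)
  fix e :: real assume e: "e > 0"
  define K' where "K' = max K 0 + 1"
  have K': "K' > 0" by (simp add: K'_def add_nonneg_pos)
  obtain z where z: "z \<in> D" "dist z x < e / (2 * K')"
    using dense e K' closure_approachable[of x D]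
    by (metis UNIV_I divide_pos_pos mult_pos_pos zero_less_numeral)
  have "\<forall>\<^sub>F i in F. dist (L i z) 0 < e / 2"
    using e by (intro tendstoD[OF on_dense[OF z(1)]]) simp
  with bound show "\<forall>\<^sub>F i in F. dist (L i x) 0 < e"
  proof eventually_elim
    case (elim i)
    have "norm (L i (x - z)) \<le> K' * norm (x - z)"
      using elim(1) by (intro order_trans[OF norm_blinfun] mult_right_mono) (auto simp: K'_def)
    also have "\<dots> \<le> K' * (e / (2 * K'))"
      using z(2) K' by (intro mult_left_mono) (auto simp: dist_norm norm_minus_commute)
    also have "\<dots> = e / 2" using K' by simp
    finally have "norm (L i (x - z) + L i z) < e / 2 + e / 2"
      using elim(2) norm_triangle_ineq[of "L i (x - z)" "L i z"] by simp
    then show ?case by (simp add: blinfun.diff_right)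
  qed
qed

section \<open>Exponentially bounded semigroups\<close>

lemma norm_quotient_diff_le_iff:
  fixes d y :: "'a::real_normed_vector"
  assumes "0 < h"
  shows "norm (d /\<^sub>R h - y) \<le> e \<longleftrightarrow> norm (d - h *\<^sub>R y) \<le> e * h"
proof -
  have "d - h *\<^sub>R y = h *\<^sub>R (d /\<^sub>R h - y)"
    using assms by (simp add: scaleR_right_diff_distrib)
  then show ?thesis using assms by (simp add: mult.commute)
qed

lemma exp_growth_le_on_interval:
  fixes M w :: real
  assumes "t \<in> {0..b}"
  shows "M * exp (w * t) \<le> \<bar>M\<bar> * exp (\<bar>w\<bar> * b)"
proof -
  have "w * t \<le> \<bar>w\<bar> * b" using assms by (intro mult_mono) auto
  then show ?thesis by (intro mult_mono) auto
qed

locale exp_bounded_semigroup =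
  fixes T :: "real \<Rightarrow> 'a::banach \<Rightarrow>\<^sub>L 'a" and M w :: real
  assumes semigroup: "C0_semigroup T"
    and bound: "0 \<le> t \<Longrightarrow> norm (T t) \<le> M * exp (w * t)"
begin

lemma zero_apply [simp]: "T 0 x = x"
  using semigroup by (simp add: C0_semigroup_def)

lemma add_apply: "0 \<le> s \<Longrightarrow> 0 \<le> t \<Longrightarrow> T (s + t) x = T s (T t x)"
  using semigroup by (simp add: C0_semigroup_def)

lemma orbit_continuous: "continuous_on {0..} (\<lambda>t. T t x)"
  using semigroup by (simp add: C0_semigroup_def)

lemma orbit_tendsto_at_right_zero: "((\<lambda>t. T t x) \<longlongrightarrow> x) (at_right 0)"
proof -
  have "((\<lambda>t. T t x) \<longlongrightarrow> T 0 x) (at 0 within {0..})"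
    by (rule orbit_continuous[unfolded continuous_on, THEN bspec]) simp
  then show ?thesis by (simp add: at_within_Ici_at_right)
qed

lemma orbit_near_start:
  assumes "0 < e"
  obtains d where "0 < d" "\<And>s. s \<in> {0..<d} \<Longrightarrow> norm (T s x - x) < e"
proof -
  obtain d where "0 < d" "\<And>s. 0 < s \<Longrightarrow> s < d \<Longrightarrow> dist (T s x) x < e"
    using tendstoD[OF orbit_tendsto_at_right_zero assms] by (auto simp: eventually_at_right_field)
  then have "norm (T s x - x) < e" if "s \<in> {0..<d}" for s
    using that assms by (cases "s = 0") (auto simp: dist_norm)
  with \<open>0 < d\<close> show thesis by (rule that)
qed

lemma norm_le_on_interval: "t \<in> {0..b} \<Longrightarrow> norm (T t) \<le> \<bar>M\<bar> * exp (\<bar>w\<bar> * b)"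
  using order_trans[OF bound exp_growth_le_on_interval[of t b M w]] by simp

lemma eventually_norm_le_at_right_zero:
  "\<forall>\<^sub>F h in at_right 0. norm (T h) \<le> \<bar>M\<bar> * exp (\<bar>w\<bar> * 1)"
  using eventually_at_right_real[OF zero_less_one]
  by eventually_elim (rule norm_le_on_interval, simp)

lemma norm_apply_le_on_interval:
  "t \<in> {0..b} \<Longrightarrow> norm (T t x) \<le> \<bar>M\<bar> * exp (\<bar>w\<bar> * b) * norm x"
  by (rule order_trans[OF norm_blinfun mult_right_mono[OF norm_le_on_interval norm_ge_zero]])

lemma subspace_generator: "subspace (generator_graph T)"
  unfolding subspace_def
proof (intro conjI ballI allI)
  show "0 \<in> generator_graph T" by (simp add: generator_graph_def zero_prod_def)
next
  fix p q assume "p \<in> generator_graph T" "q \<in> generator_graph T"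
  then have "((\<lambda>h. (T h (fst p) - fst p) /\<^sub>R h + (T h (fst q) - fst q) /\<^sub>R h)
      \<longlongrightarrow> snd p + snd q) (at_right 0)"
    by (intro tendsto_add) (auto simp: generator_graph_def)
  then show "p + q \<in> generator_graph T"
    by (cases p; cases q) (simp add: generator_graph_def blinfun.add_right algebra_simps)
next
  fix c p assume "p \<in> generator_graph T"
  then have "((\<lambda>h. c *\<^sub>R ((T h (fst p) - fst p) /\<^sub>R h)) \<longlongrightarrow> c *\<^sub>R snd p) (at_right 0)"
    by (intro tendsto_scaleR tendsto_const) (auto simp: generator_graph_def)
  then show "c *\<^sub>R p \<in> generator_graph T"
    by (cases p) (simp add: generator_graph_def blinfun.scaleR_right algebra_simps)
qed

lemma generator_orbit:
  assumes "(x, y) \<in> generator_graph T" "0 \<le> t"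
  shows "(T t x, T t y) \<in> generator_graph T"
proof -
  have "((\<lambda>h. T t ((T h x - x) /\<^sub>R h)) \<longlongrightarrow> T t y) (at_right 0)"
    using assms(1) by (intro tendsto_intros) (simp add: generator_graph_def)
  moreover have "\<forall>\<^sub>F h in at_right 0. T t ((T h x - x) /\<^sub>R h) = (T h (T t x) - T t x) /\<^sub>R h"
    using eventually_at_right_less[of "0::real"]
  proof eventually_elim
    case (elim h)
    have "T t (T h x) = T h (T t x)"
      using add_apply[of t h x] add_apply[of h t x] elim assms(2) by (simp add: add.commute)
    then show ?case by (simp add: blinfun.scaleR_right blinfun.diff_right)
  qed
  ultimately show ?thesis
    by (simp add: generator_graph_def tendsto_cong)
qed

lemma generator_graphI:
  assumes "\<And>h e. 0 < h \<Longrightarrow> (\<And>s. s \<in> {0..h} \<Longrightarrow> norm (T s y - y) \<le> e) \<Longrightarrow>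
    norm (T h x - x - h *\<^sub>R y) \<le> e * h"
  shows "(x, y) \<in> generator_graph T"
  unfolding generator_graph_def mem_Collect_eq prod.case
proof (rule tendstoI)
  fix e :: real assume e: "0 < e"
  then obtain d where d: "0 < d" "\<And>s. s \<in> {0..<d} \<Longrightarrow> norm (T s y - y) < e / 2"
    using orbit_near_start[of "e / 2" y] by auto
  have "dist ((T h x - x) /\<^sub>R h) y < e" if h: "0 < h" "h < d" for h
  proof -
    have "norm (T h x - x - h *\<^sub>R y) \<le> e / 2 * h"
      using h by (intro assms less_imp_le[OF d(2)]) auto
    then have "norm ((T h x - x) /\<^sub>R h - y) \<le> e / 2"
      by (rule norm_quotient_diff_le_iff[OF h(1), THEN iffD2])
    with e show ?thesis by (simp add: dist_norm)
  qed
  then show "\<forall>\<^sub>F h in at_right 0. dist ((T h x - x) /\<^sub>R h) y < e"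
    unfolding eventually_at_right_field using d(1) by blast
qed

lemma discrete_orbit_increment_le:
  assumes \<delta>: "0 < \<delta>" and y: "\<And>s. s \<in> {0..real n * \<delta>} \<Longrightarrow> norm (T s y - c) \<le> e"
  shows "norm (T (real n * \<delta>) x - x - (real n * \<delta>) *\<^sub>R c)
    \<le> (\<bar>M\<bar> * exp (\<bar>w\<bar> * (real n * \<delta>)) * norm ((T \<delta> x - x) /\<^sub>R \<delta> - y) + e) * (real n * \<delta>)"
proof -
  define K where "K = \<bar>M\<bar> * exp (\<bar>w\<bar> * (real n * \<delta>))"
  define q where "q = (T \<delta> x - x) /\<^sub>R \<delta>"
  let ?s = "\<lambda>k. real k * \<delta>"
  have increment: "T (?s (Suc k)) x - T (?s k) x = \<delta> *\<^sub>R T (?s k) q" for k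
    using \<delta> add_apply[of "?s k" \<delta> x]
    by (simp add: q_def blinfun.scaleR_right blinfun.diff_right distrib_right add.commute)
  have "T (?s n) x - x - ?s n *\<^sub>R c = (\<Sum>k<n. T (?s (Suc k)) x - T (?s k) x) - (\<Sum>k<n. \<delta> *\<^sub>R c)"
    using sum_lessThan_telescope[of "\<lambda>k. T (?s k) x" n] by (simp add: sum_constant_scaleR)
  also have "\<dots> = (\<Sum>k<n. \<delta> *\<^sub>R (T (?s k) (q - y) + (T (?s k) y - c)))"
    unfolding sum_subtractf[symmetric] increment by (simp add: blinfun.diff_right algebra_simps)
  also have "norm \<dots> \<le> (\<Sum>k<n. \<delta> * (K * norm (q - y) + e))"
  proof (rule sum_norm_le)
    fix k assume "k \<in> {..<n}"
    then have k: "?s k \<in> {0..?s n}" using \<delta> by simp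
    have "norm (T (?s k) (q - y) + (T (?s k) y - c)) \<le> K * norm (q - y) + e"
      unfolding K_def by (intro norm_triangle_le add_mono norm_apply_le_on_interval y k)
    then show "norm (\<delta> *\<^sub>R (T (?s k) (q - y) + (T (?s k) y - c))) \<le> \<delta> * (K * norm (q - y) + e)"
      using \<delta> by simp
  qed
  also have "\<dots> = (K * norm (q - y) + e) * ?s n" by simp
  finally show ?thesis unfolding K_def q_def .
qed

lemma orbit_increment_le:
  assumes xy: "(x, y) \<in> generator_graph T" and h: "0 \<le> h"
    and y: "\<And>s. s \<in> {0..h} \<Longrightarrow> norm (T s y - c) \<le> e"
  shows "norm (T h x - x - h *\<^sub>R c) \<le> e * h"
proof (cases "h = 0")
  case False
  define K where "K = \<bar>M\<bar> * exp (\<bar>w\<bar> * h)"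
  define q where "q \<delta> = (T \<delta> x - x) /\<^sub>R \<delta>" for \<delta>
  define \<delta> where "\<delta> n = h / real (Suc n)" for n
  have \<delta>: "0 < \<delta> n" "real (Suc n) * \<delta> n = h" for n
    using False h by (auto simp: \<delta>_def)
  have "\<delta> \<longlonglongrightarrow> 0"
    unfolding \<delta>_def by (rule LIMSEQ_Suc[OF lim_const_over_n])
  then have "filterlim \<delta> (at_right 0) sequentially"
    using \<delta>(1) by (auto intro: tendsto_imp_filterlim_at_right)
  then have "(\<lambda>n. q (\<delta> n)) \<longlonglongrightarrow> y"
    using xy unfolding generator_graph_def q_def by (auto intro: filterlim_compose)
  then have "(\<lambda>n. (K * norm (q (\<delta> n) - y) + e) * h) \<longlonglongrightarrow> (K * norm (y - y) + e) * h"
    by (intro tendsto_intros)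
  moreover have "norm (T h x - x - h *\<^sub>R c) \<le> (K * norm (q (\<delta> n) - y) + e) * h" for n
    using discrete_orbit_increment_le[OF \<delta>(1), of "Suc n" n y c e x] y
    unfolding \<delta>(2) K_def q_def by blast
  ultimately have "norm (T h x - x - h *\<^sub>R c) \<le> (K * norm (y - y) + e) * h"
    by (intro tendsto_lowerbound) auto
  then show ?thesis by simp
qed simp

subsection \<open>Integrals of orbits\<close>

lemma orbit_integrable: "0 \<le> a \<Longrightarrow> (\<lambda>s. T s x) integrable_on {a..b}"
  by (intro integrable_continuous_real continuous_on_subset[OF orbit_continuous]) auto

lemma orbit_integral_average_tendsto:
  "((\<lambda>h. integral {0..h} (\<lambda>s. T s x) /\<^sub>R h) \<longlongrightarrow> x) (at_right 0)"
proof (rule tendstoI)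
  fix e :: real assume e: "0 < e"
  then obtain d where d: "0 < d" "\<And>s. s \<in> {0..<d} \<Longrightarrow> norm (T s x - x) < e / 2"
    using orbit_near_start[of "e / 2" x] by auto
  have "dist (integral {0..h} (\<lambda>s. T s x) /\<^sub>R h) x < e" if h: "0 < h" "h < d" for h
  proof -
    have "norm (integral {0..h} (\<lambda>s. T s x - x)) \<le> e / 2 * (h - 0)"
      using h less_imp_le[OF d(2)]
      by (intro integral_bound continuous_on_diff continuous_on_subset[OF orbit_continuous]) auto
    moreover have "integral {0..h} (\<lambda>s. T s x - x) = integral {0..h} (\<lambda>s. T s x) - h *\<^sub>R x"
      using h by (subst Henstock_Kurzweil_Integration.integral_diff) (auto simp: orbit_integrable)
    ultimately have "norm (integral {0..h} (\<lambda>s. T s x) /\<^sub>R h - x) \<le> e / 2"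
      by (simp only: norm_quotient_diff_le_iff[OF h(1)] diff_zero)
    with e show ?thesis by (simp add: dist_norm)
  qed
  then show "\<forall>\<^sub>F h in at_right 0. dist (integral {0..h} (\<lambda>s. T s x) /\<^sub>R h) x < e"
    unfolding eventually_at_right_field using d(1) by blast
qed

lemma orbit_integral_add:
  assumes "0 \<le> a" "0 \<le> b"
  shows "integral {0..a + b} (\<lambda>s. T s x)
    = integral {0..a} (\<lambda>s. T s x) + T a (integral {0..b} (\<lambda>s. T s x))"
proof -
  have "T a (integral {0..b} (\<lambda>s. T s x)) = integral {0..b} (\<lambda>s. T a (T s x))"
    by (rule integral_linear[OF orbit_integrable blinfun.bounded_linear_right,
          unfolded o_def, symmetric]) simp
  also have "\<dots> = integral {0..b} (\<lambda>s. T (s + a) x)"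
    by (intro integral_cong) (use assms in \<open>auto simp: add_apply[symmetric] add.commute\<close>)
  also have "\<dots> = integral {a..a + b} (\<lambda>s. T s x)"
    using integral_shift_real_ivl[of a a "a + b" "\<lambda>s. T s x"] by simp
  finally show ?thesis
    using assms by (simp add: Henstock_Kurzweil_Integration.integral_combine orbit_integrable)
qed

lemma orbit_integral_in_generator:
  assumes b: "0 \<le> b"
  shows "(integral {0..b} (\<lambda>s. T s x), T b x - x) \<in> generator_graph T"
proof -
  define J where "J b = integral {0..b} (\<lambda>s. T s x)" for b
  have "((\<lambda>h. T b (J h /\<^sub>R h) - J h /\<^sub>R h) \<longlongrightarrow> T b x - x) (at_right 0)"
    unfolding J_def by (intro tendsto_intros orbit_integral_average_tendsto)
  moreover have "\<forall>\<^sub>F h in at_right 0. T b (J h /\<^sub>R h) - J h /\<^sub>R h = (T h (J b) - J b) /\<^sub>R h"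
    using eventually_at_right_less[of "0::real"]
  proof eventually_elim
    case (elim h)
    have "J b + T b (J h) = J h + T h (J b)"
      using orbit_integral_add[of b h x] orbit_integral_add[of h b x] b elim
      by (simp add: J_def add.commute)
    then have "T b (J h) - J h = T h (J b) - J b" by (simp add: algebra_simps)
    then show ?case by (simp add: blinfun.scaleR_right flip: scaleR_right_diff_distrib)
  qed
  ultimately show ?thesis
    unfolding generator_graph_def J_def[symmetric] by (simp add: tendsto_cong)
qed

lemma generator_dense: "closure (Domain (generator_graph T)) = UNIV"
proof -
  have "x \<in> closure (Domain (generator_graph T))" for x
  proof (rule Lim_in_closed_set[OF closed_closure _ _ orbit_integral_average_tendsto])
    show "\<forall>\<^sub>F h in at_right 0. integral {0..h} (\<lambda>s. T s x) /\<^sub>R h \<in> closure (Domain (generator_graph T))"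
      using eventually_at_right_less[of "0::real"]
    proof eventually_elim
      case (elim h)
      then have "inverse h *\<^sub>R (integral {0..h} (\<lambda>s. T s x), T h x - x) \<in> generator_graph T"
        by (intro subspace_scale[OF subspace_generator] orbit_integral_in_generator) simp
      then show ?case by (intro subsetD[OF closure_subset]) auto
    qed
  qed simp
  then show ?thesis by auto
qed

subsection \<open>Resolvents\<close>

lemma rescaled: "exp_bounded_semigroup (\<lambda>t. exp (c * t) *\<^sub>R T t) M (w + c)"
proof
  show "C0_semigroup (\<lambda>t. exp (c * t) *\<^sub>R T t)"
    unfolding C0_semigroup_def
  proof (intro conjI allI impI)
    show "exp (c * 0) *\<^sub>R T 0 = id_blinfun" by (rule blinfun_eqI) simp
    show "exp (c * (t + s)) *\<^sub>R T (t + s) = (exp (c * t) *\<^sub>R T t) o\<^sub>L (exp (c * s) *\<^sub>R T s)"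
      if "0 \<le> t" "0 \<le> s" for t s
      using that by (intro blinfun_eqI)
        (simp add: scaleR_blinfun.rep_eq add_apply blinfun.scaleR_right distrib_left exp_add)
    show "continuous_on {0..} (\<lambda>t. (exp (c * t) *\<^sub>R T t) x)" for x
      by (simp add: scaleR_blinfun.rep_eq) (intro continuous_intros orbit_continuous)
  qed
  show "norm (exp (c * t) *\<^sub>R T t) \<le> M * exp ((w + c) * t)" if "0 \<le> t" for t
    using mult_left_mono[OF bound[OF that], of "exp (c * t)"]
    by (simp only: distrib_right exp_add norm_scaleR) (simp add: mult_ac)
qed

lemma generator_rescaled:
  assumes "(x, y) \<in> generator_graph T"
  shows "(x, y + c *\<^sub>R x) \<in> generator_graph (\<lambda>t. exp (c * t) *\<^sub>R T t)"
proof -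
  have "((\<lambda>h. exp (c * h)) has_field_derivative c) (at 0)"
    by (auto intro!: derivative_eq_intros)
  then have exp_quotient: "((\<lambda>h. (exp (c * h) - 1) / h) \<longlongrightarrow> c) (at_right 0)"
    using tendsto_within_subset[of _ _ 0 UNIV "{0<..}"] by (auto simp: DERIV_def)
  have quotient: "((\<lambda>h. (T h x - x) /\<^sub>R h) \<longlongrightarrow> y) (at_right 0)"
    using assms by (simp add: generator_graph_def)
  have "((\<lambda>h. exp (c * h) *\<^sub>R ((T h x - x) /\<^sub>R h) + ((exp (c * h) - 1) / h) *\<^sub>R x)
      \<longlongrightarrow> exp (c * 0) *\<^sub>R y + c *\<^sub>R x) (at_right 0)"
    by (intro tendsto_intros exp_quotient quotient)
  then show ?thesis
    by (simp add: generator_graph_def scaleR_blinfun.rep_eq algebra_simps divide_inverse)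
qed

lemma ex_norm_less_if_negative_growth:
  assumes "w < 0" "0 < c"
  obtains t where "0 \<le> t" "norm (T t) < c"
proof -
  have "filterlim (\<lambda>t. w * t) at_bot at_top"
    using assms(1) by (intro filterlim_tendsto_neg_mult_at_bot[OF tendsto_const _ filterlim_ident])
  then have "((\<lambda>t. M * exp (w * t)) \<longlongrightarrow> 0) at_top"
    by (intro tendsto_mult_right_zero filterlim_compose[OF exp_at_bot])
  then have "\<forall>\<^sub>F t in at_top. M * exp (w * t) < c \<and> 0 \<le> t"
    using assms(2) by (intro eventually_conj order_tendstoD(2) eventually_ge_at_top)
  then obtain t where "M * exp (w * t) < c" "0 \<le> t" by (auto simp: eventually_at_top_linorder)
  with bound[of t] that show thesis by force
qed

lemma ex_generator_eq_shifted:
  assumes "w < l"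
  shows "\<exists>x. (x, l *\<^sub>R x - z) \<in> generator_graph T"
proof -
  let ?S = "\<lambda>t. exp (- l * t) *\<^sub>R T t"
  interpret S: exp_bounded_semigroup ?S M "w + (- l)"
    by (rule rescaled)
  obtain t where t: "0 \<le> t" "norm (?S t) < 1 / 2"
    using S.ex_norm_less_if_negative_growth[of "1 / 2"] assms by auto
  have "\<exists>!z'. z + ?S t z' = z'"
  proof (rule banach_fix_type[of "1/2"])
    have "norm (?S t (a - b)) \<le> 1 / 2 * norm (a - b)" for a b
      using t(2) by (intro order_trans[OF norm_blinfun] mult_right_mono) auto
    then show "\<forall>a b. dist (z + ?S t a) (z + ?S t b) \<le> 1 / 2 * dist a b"
      by (simp add: dist_norm blinfun.diff_right)
  qed auto
  then obtain z' where "z + ?S t z' = z'" by blast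
  then have z': "?S t z' - z' = - z" by (simp add: algebra_simps eq_neg_iff_add_eq_0)
  define x where "x = integral {0..t} (\<lambda>s. ?S s z')"
  have "(x, - z) \<in> generator_graph ?S"
    unfolding x_def z'[symmetric] by (rule S.orbit_integral_in_generator[OF t(1)])
  then have "(x, - z + l *\<^sub>R x) \<in> generator_graph (\<lambda>t. exp (l * t) *\<^sub>R ?S t)"
    by (rule S.generator_rescaled)
  moreover have "(\<lambda>t. exp (l * t) *\<^sub>R ?S t) = T"
    by (simp add: fun_eq_iff exp_minus)
  ultimately show ?thesis by (auto intro!: exI[of _ x])
qed

lemma no_generator_eigenvalue:
  assumes "w < l" and x: "(x, l *\<^sub>R x) \<in> generator_graph T"
  shows "x = 0"
proof (rule ccontr)
  assume "x \<noteq> 0"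
  let ?S = "\<lambda>t. exp (- l * t) *\<^sub>R T t"
  interpret S: exp_bounded_semigroup ?S M "w + (- l)"
    by (rule rescaled)
  obtain t where t: "0 \<le> t" "norm (?S t) < 1"
    using S.ex_norm_less_if_negative_growth[of 1] assms by auto
  have "(x, 0) \<in> generator_graph ?S"
    using generator_rescaled[OF x, of "- l"] by simp
  then have "norm (?S t x - x - t *\<^sub>R 0) \<le> 0 * t"
    using t(1) by (rule S.orbit_increment_le) simp
  then have "norm x = norm (?S t x)" by simp
  also have "\<dots> \<le> norm (?S t) * norm x" by (rule norm_blinfun)
  also have "\<dots> < 1 * norm x" using t(2) \<open>x \<noteq> 0\<close> by (intro mult_strict_right_mono) auto
  finally show False by simp
qed

lemma resolvent_generator:
  assumes gen: "generates D A T" and l: "w < l"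
  shows "(resolvent l D A z, l *\<^sub>R resolvent l D A z - z) \<in> generator_graph T"
    and "(x, y) \<in> generator_graph T \<Longrightarrow> resolvent l D A (l *\<^sub>R x - y) = x"
proof -
  have graph: "(x, y) \<in> generator_graph T \<longleftrightarrow> x \<in> D \<and> y = A x" for x y
    using gen by (auto simp: generates_def op_graph_def)
  let ?f = "\<lambda>y. l *\<^sub>R y - A y"
  have inj: "inj_on ?f D"
  proof (rule inj_onI)
    fix x y assume xy: "x \<in> D" "y \<in> D" "?f x = ?f y"
    then have "(x, A x) - (y, A y) \<in> generator_graph T"
      using graph by (intro subspace_diff[OF subspace_generator]) auto
    moreover have "A x - A y = l *\<^sub>R (x - y)" using xy(3) by (simp add: algebra_simps)
    ultimately show "x = y" using no_generator_eigenvalue[OF l, of "x - y"] by simp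
  qed
  have surj: "z \<in> ?f ` D" for z
  proof -
    obtain x where "(x, l *\<^sub>R x - z) \<in> generator_graph T"
      using ex_generator_eq_shifted[OF l] by blast
    then have "x \<in> D" "l *\<^sub>R x - z = A x" using graph by auto
    then show ?thesis by (intro image_eqI[of _ _ x]) (auto simp: algebra_simps)
  qed
  have "resolvent l D A z \<in> D"
    unfolding resolvent_def by (rule the_inv_into_into[OF inj surj]) simp
  moreover have "?f (resolvent l D A z) = z"
    unfolding resolvent_def by (rule f_the_inv_into_f[OF inj surj])
  ultimately show "(resolvent l D A z, l *\<^sub>R resolvent l D A z - z) \<in> generator_graph T"
    unfolding graph by (auto simp: algebra_simps)
  show "(x, y) \<in> generator_graph T \<Longrightarrow> resolvent l D A (l *\<^sub>R x - y) = x"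
    unfolding graph resolvent_def using the_inv_into_f_f[OF inj, of x] by auto
qed

end

lemma norm_semigroup_increment_le:
  fixes T :: "real \<Rightarrow> 'a::real_normed_vector \<Rightarrow>\<^sub>L 'a"
  assumes add: "\<And>s t. 0 \<le> s \<Longrightarrow> 0 \<le> t \<Longrightarrow> T (s + t) = T s o\<^sub>L T t" and "0 \<le> s" "0 \<le> t"
  shows "norm (T s x - T t x) \<le> norm (T (min s t)) * norm (T \<bar>s - t\<bar> x - x)"
proof -
  have "T (max s t) x - T (min s t) x = T (min s t) (T \<bar>s - t\<bar> x - x)"
    using add[of s "t - s"] add[of t "s - t"] assms(2,3)
    by (cases "s \<le> t") (simp_all add: blinfun.diff_right)
  moreover have "norm (T s x - T t x) = norm (T (max s t) x - T (min s t) x)"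
    by (simp add: min_def max_def norm_minus_commute)
  ultimately show ?thesis by (simp add: norm_blinfun)
qed

lemma C0_semigroupI:
  fixes T :: "real \<Rightarrow> 'a::real_normed_vector \<Rightarrow>\<^sub>L 'a"
  assumes zero: "T 0 = id_blinfun"
    and add: "\<And>s t. 0 \<le> s \<Longrightarrow> 0 \<le> t \<Longrightarrow> T (s + t) = T s o\<^sub>L T t"
    and bound: "\<And>t. 0 \<le> t \<Longrightarrow> norm (T t) \<le> M * exp (w * t)"
    and right: "\<And>x. ((\<lambda>t. T t x) \<longlongrightarrow> x) (at_right 0)"
  shows "C0_semigroup T"
  unfolding C0_semigroup_def
proof (intro conjI allI impI zero add)
  fix x
  show "continuous_on {0..} (\<lambda>t. T t x)"
    unfolding continuous_on
  proof
    fix t :: real assume "t \<in> {0..}"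
    then have t: "0 \<le> t" by simp
    have "((\<lambda>s. \<bar>s - t\<bar>) \<longlongrightarrow> \<bar>t - t\<bar>) (at t within {0..})"
      by (intro tendsto_intros)
    then have "filterlim (\<lambda>s. \<bar>s - t\<bar>) (at_right 0) (at t within {0..})"
      by (intro tendsto_imp_filterlim_at_right) (auto simp: eventually_at_filter)
    then have "((\<lambda>s. T \<bar>s - t\<bar> x) \<longlongrightarrow> x) (at t within {0..})"
      by (rule filterlim_compose[OF right])
    moreover have "((\<lambda>s. M * exp (w * min s t)) \<longlongrightarrow> M * exp (w * min t t)) (at t within {0..})"
      by (intro tendsto_intros)
    ultimately have "((\<lambda>s. M * exp (w * min s t) * norm (T \<bar>s - t\<bar> x - x)) \<longlongrightarrow>
        M * exp (w * min t t) * norm (x - x)) (at t within {0..})"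
      by (intro tendsto_intros)
    then have lim: "((\<lambda>s. M * exp (w * min s t) * norm (T \<bar>s - t\<bar> x - x)) \<longlongrightarrow> 0) (at t within {0..})"
      by simp
    have "norm (T s x - T t x) \<le> M * exp (w * min s t) * norm (T \<bar>s - t\<bar> x - x)" if "0 \<le> s" for s
      using that t
      by (intro order_trans[OF norm_semigroup_increment_le[OF add] mult_right_mono[OF bound]]) auto
    then have "\<forall>\<^sub>F s in at t within {0..}.
        norm (T s x - T t x) \<le> M * exp (w * min s t) * norm (T \<bar>s - t\<bar> x - x)"
      by (simp add: eventually_at_filter)
    then have "((\<lambda>s. T s x - T t x) \<longlongrightarrow> 0) (at t within {0..})"
      by (rule Lim_null_comparison[OF _ lim])
    then show "((\<lambda>s. T s x) \<longlongrightarrow> T t x) (at t within {0..})"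
      by (rule Lim_null[THEN iffD2])
  qed
qed

section \<open>Chernoff's product formula\<close>

abbreviation blinfun_power :: "('a::real_normed_vector \<Rightarrow>\<^sub>L 'a) \<Rightarrow> nat \<Rightarrow> 'a \<Rightarrow>\<^sub>L 'a" where
  "blinfun_power V \<equiv> prod_decreasing (\<lambda>_. V)"

lemma norm_blinfun_power_error_le:
  assumes "\<And>k. k \<le> n \<Longrightarrow> norm (blinfun_power V k) \<le> K"
    and "\<And>k. k < n \<Longrightarrow> norm (V (v k) - v (Suc k)) \<le> d"
  shows "norm (blinfun_power V n (v 0) - v n) \<le> real n * (K * d)"
  using assms
proof (induction n arbitrary: v)
  case (Suc n)
  have "blinfun_power V (Suc n) (v 0) - v (Suc n)
      = blinfun_power V n (V (v 0) - v 1) + (blinfun_power V n (v 1) - v (Suc n))"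
    by (simp add: blinfun.diff_right)
  also have "norm \<dots> \<le> K * d + real n * (K * d)"
  proof (intro norm_triangle_le add_mono)
    have "0 \<le> K" using Suc.prems(1)[of 0] norm_ge_zero order_trans by blast
    then show "norm (blinfun_power V n (V (v 0) - v 1)) \<le> K * d"
      using Suc.prems(1)[of n] Suc.prems(2)[of 0]
      by (intro order_trans[OF norm_blinfun mult_mono]) auto
    show "norm (blinfun_power V n (v 1) - v (Suc n)) \<le> real n * (K * d)"
      using Suc.IH[of "\<lambda>k. v (Suc k)"] Suc.prems by simp
  qed
  finally show ?case by (simp add: algebra_simps)
qed simp

definition moving_average :: "nat \<Rightarrow> (nat \<Rightarrow> 'a::real_vector) \<Rightarrow> nat \<Rightarrow> 'a" where
  "moving_average Q u k = (\<Sum>q<Q. u (k + q)) /\<^sub>R real Q"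

lemma moving_average_diff:
  "moving_average Q (\<lambda>k. u k - v k) k = moving_average Q u k - moving_average Q v k"
  by (simp add: moving_average_def sum_subtractf scaleR_right_diff_distrib)

lemma moving_average_increment:
  "moving_average Q u (Suc k) - moving_average Q u k = (u (k + Q) - u k) /\<^sub>R real Q"
  using sum_lessThan_telescope[of "\<lambda>q. u (k + q)" Q]
  by (simp add: moving_average_def flip: scaleR_right_diff_distrib sum_subtractf)

lemma moving_average_Suc: "moving_average Q (\<lambda>k. u (Suc k)) k = moving_average Q u (Suc k)"
  by (simp add: moving_average_def)

lemma blinfun_moving_average:
  "blinfun_apply V (moving_average Q u k) = moving_average Q (\<lambda>k. V (u k)) k"
  by (simp add: moving_average_def blinfun.scaleR_right blinfun.sum_right)

lemma norm_moving_average_le: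
  fixes u :: "nat \<Rightarrow> 'a::real_normed_vector"
  assumes "0 < Q" "\<And>q. q < Q \<Longrightarrow> norm (u (k + q)) \<le> e"
  shows "norm (moving_average Q u k) \<le> e"
proof -
  have "norm (\<Sum>q<Q. u (k + q)) \<le> (\<Sum>q<Q. e)"
    by (rule sum_norm_le) (use assms(2) in simp)
  then show ?thesis
    using assms(1) by (simp add: moving_average_def field_simps)
qed

text \<open>Averaging over \<open>Q\<close> steps replaces the uncontrolled increments of \<open>z - u\<close> by boundary terms
  of size \<open>\<eta> / Q\<close>.\<close>

lemma norm_blinfun_power_moving_average_error_le:
  assumes stable: "\<And>k. k \<le> n \<Longrightarrow> norm (blinfun_power V k) \<le> K" and Q: "0 < Q"
    and near: "\<And>k. k \<le> n + Q \<Longrightarrow> norm (z k - u k) \<le> \<eta>"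
    and step: "\<And>k. k < n + Q \<Longrightarrow> norm (V (z k) - z k - (u (Suc k) - u k)) \<le> \<eta> * h"
  shows "norm (blinfun_power V n (moving_average Q u 0) - moving_average Q u n)
    \<le> \<eta> * (K + 1 + real n * K * (h + 2 / real Q))"
proof -
  let ?m = "moving_average Q" and ?P = "blinfun_power V n"
  have K: "0 \<le> K" using stable[of 0] norm_ge_zero order_trans by blast
  have averages: "norm (?m z k - ?m u k) \<le> \<eta>" if "k \<le> n" for k
    unfolding moving_average_diff[symmetric]
    by (rule norm_moving_average_le[OF Q]) (use near that in auto)
  have powers: "norm (?P (?m z 0) - ?m z n) \<le> real n * (K * (\<eta> * h + (\<eta> + \<eta>) / real Q))"
  proof (rule norm_blinfun_power_error_le[OF stable])
    fix k assume k: "k < n"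
    define w where "w = (\<lambda>k. z k - u k)"
    have "V (?m z k) - ?m z (Suc k)
        = ?m (\<lambda>k. V (z k) - z k - (u (Suc k) - u k)) k - (?m w (Suc k) - ?m w k)"
      by (simp add: blinfun_moving_average moving_average_diff moving_average_Suc w_def)
    also have "\<dots> = ?m (\<lambda>k. V (z k) - z k - (u (Suc k) - u k)) k - (w (k + Q) - w k) /\<^sub>R real Q"
      by (simp only: moving_average_increment)
    also have "norm \<dots> \<le> \<eta> * h + (\<eta> + \<eta>) / real Q"
    proof (intro norm_triangle_le_diff add_mono)
      show "norm (?m (\<lambda>k. V (z k) - z k - (u (Suc k) - u k)) k) \<le> \<eta> * h"
        by (rule norm_moving_average_le[OF Q]) (use step k in auto)
      have "norm (w (k + Q) - w k) \<le> \<eta> + \<eta>"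
        unfolding w_def by (intro norm_triangle_le_diff add_mono near) (use k in auto)
      then show "norm ((w (k + Q) - w k) /\<^sub>R real Q) \<le> (\<eta> + \<eta>) / real Q"
        by (simp add: divide_right_mono divide_inverse_commute mult_left_mono)
    qed
    finally show "norm (V (?m z k) - ?m z (Suc k)) \<le> \<eta> * h + (\<eta> + \<eta>) / real Q" .
  qed
  have initial: "norm (?P (?m z 0 - ?m u 0)) \<le> K * \<eta>"
    using averages[of 0] stable[of n] K by (intro order_trans[OF norm_blinfun mult_mono]) auto
  have "?P (?m u 0) - ?m u n = (?P (?m z 0) - ?m z n) - ?P (?m z 0 - ?m u 0) + (?m z n - ?m u n)"
    by (simp add: blinfun.diff_right)
  also have "norm \<dots> \<le> real n * (K * (\<eta> * h + (\<eta> + \<eta>) / real Q)) + K * \<eta> + \<eta>"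
    by (intro norm_triangle_le norm_triangle_le_diff add_mono powers initial averages) simp
  also have "\<dots> = \<eta> * (K + 1 + real n * K * (h + 2 / real Q))"
    by (simp add: algebra_simps)
  finally show ?thesis .
qed

text \<open>The lower limit of the graphs of the difference quotients \<open>(V i - I) / h i\<close>.\<close>

definition generator_limit ::
  "('i \<Rightarrow> 'a::real_normed_vector \<Rightarrow>\<^sub>L 'a) \<Rightarrow> ('i \<Rightarrow> real) \<Rightarrow> 'i filter \<Rightarrow> ('a \<times> 'a) set" where
  "generator_limit V h F = {(x, y). \<forall>e>0. \<forall>\<^sub>F i in F. \<exists>z.
     norm (z - x) \<le> e \<and> norm (V i z - z - h i *\<^sub>R y) \<le> e * h i}"

lemma generator_limitI:
  fixes V :: "'i \<Rightarrow> 'a::real_normed_vector \<Rightarrow>\<^sub>L 'a"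
  assumes h: "\<forall>\<^sub>F i in F. 0 < h i" and z: "(z \<longlongrightarrow> x) F"
    and quotient: "((\<lambda>i. (V i (z i) - z i) /\<^sub>R h i) \<longlongrightarrow> y) F"
  shows "(x, y) \<in> generator_limit V h F"
  unfolding generator_limit_def mem_Collect_eq prod.case
proof (intro allI impI)
  fix e :: real assume "e > 0"
  from h tendstoD[OF z this] tendstoD[OF quotient this]
  show "\<forall>\<^sub>F i in F. \<exists>z. norm (z - x) \<le> e \<and> norm (V i z - z - h i *\<^sub>R y) \<le> e * h i"
  proof eventually_elim
    case (elim i)
    have "norm (V i (z i) - z i - h i *\<^sub>R y) \<le> e * h i"
      using elim(3) by (simp add: dist_norm less_imp_le flip: norm_quotient_diff_le_iff[OF elim(1)])
    then show ?case using elim(2) by (auto simp: dist_norm intro!: exI[of _ "z i"])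
  qed
qed

lemma generator_limit_approximant_near:
  fixes V :: "'a::real_normed_vector \<Rightarrow>\<^sub>L 'a"
  assumes "norm (z - x) \<le> e" "norm (V z - z - h *\<^sub>R y) \<le> e * h" "0 \<le> h" "dist (x', y') (x, y) \<le> d"
  shows "norm (z - x') \<le> e + d" "norm (V z - z - h *\<^sub>R y') \<le> (e + d) * h"
proof -
  have d: "norm (x - x') \<le> d" "norm (y - y') \<le> d"
    using assms(4) dist_fst_le[of "(x', y')" "(x, y)"] dist_snd_le[of "(x', y')" "(x, y)"]
    by (auto simp: dist_norm norm_minus_commute)
  show "norm (z - x') \<le> e + d"
    using norm_triangle_le[OF add_mono[OF assms(1) d(1)]] by simp
  have "norm (h *\<^sub>R (y - y')) \<le> d * h"
    using d(2) assms(3) by (simp add: mult.commute[of d] mult_left_mono)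
  from norm_triangle_le[OF add_mono[OF assms(2) this]]
  show "norm (V z - z - h *\<^sub>R y') \<le> (e + d) * h" by (simp add: algebra_simps)
qed

lemma closed_generator_limit:
  assumes h: "\<forall>\<^sub>F i in F. 0 \<le> h i"
  shows "closed (generator_limit V h F)"
proof -
  have "(x, y) \<in> generator_limit V h F" if xy: "(x, y) \<in> closure (generator_limit V h F)" for x y
    unfolding generator_limit_def mem_Collect_eq prod.case
  proof (intro allI impI)
    fix e :: real assume "e > 0"
    then have e: "e / 2 > 0" by simp
    then obtain x' y' where xy': "(x', y') \<in> generator_limit V h F"
      and near: "dist (x, y) (x', y') < e / 2"
      using xy unfolding closure_approachable by (metis dist_commute surj_pair)
    have "\<forall>\<^sub>F i in F. \<exists>z. norm (z - x') \<le> e / 2 \<and> norm (V i z - z - h i *\<^sub>R y') \<le> e / 2 * h i"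
      using xy' e unfolding generator_limit_def by blast
    with h show "\<forall>\<^sub>F i in F. \<exists>z. norm (z - x) \<le> e \<and> norm (V i z - z - h i *\<^sub>R y) \<le> e * h i"
    proof eventually_elim
      case (elim i)
      then show ?case
        using generator_limit_approximant_near[OF _ _ elim(1) less_imp_le[OF near]] by fastforce
    qed
  qed
  then show ?thesis unfolding closure_subset_eq[symmetric] by auto
qed

lemma closure_op_graph_le_generator_limit:
  fixes V :: "real \<Rightarrow> 'a::real_normed_vector \<Rightarrow>\<^sub>L 'a"
  assumes h: "filterlim h (at_right 0) F"
    and consistent: "\<And>g. g \<in> D \<Longrightarrow> ((\<lambda>h. (V h g - g) /\<^sub>R h) \<longlongrightarrow> C g) (at_right 0)"
  shows "closure (op_graph D C) \<subseteq> generator_limit (\<lambda>i. V (h i)) h F"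
proof (rule closure_minimal)
  have h_pos: "\<forall>\<^sub>F i in F. 0 < h i"
    by (rule eventually_compose_filterlim[OF eventually_at_right_less h])
  show "op_graph D C \<subseteq> generator_limit (\<lambda>i. V (h i)) h F"
    using generator_limitI[OF h_pos tendsto_const filterlim_compose[OF consistent h]]
    by (auto simp: op_graph_def)
  show "closed (generator_limit (\<lambda>i. V (h i)) h F)"
    using h_pos by (intro closed_generator_limit) (auto elim: eventually_mono)
qed

lemma generator_limit_uniform_on_compact:
  fixes V :: "'i \<Rightarrow> 'a::real_normed_vector \<Rightarrow>\<^sub>L 'a"
  assumes C: "compact C" "C \<subseteq> generator_limit V h F" and h: "\<forall>\<^sub>F i in F. 0 \<le> h i" and e: "e > 0"
  shows "\<forall>\<^sub>F i in F. \<forall>(x, y)\<in>C. \<exists>z. norm (z - x) \<le> e \<and> norm (V i z - z - h i *\<^sub>R y) \<le> e * h i"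
proof -
  have "\<forall>\<^sub>F (i, q) in F \<times>\<^sub>F nhds p. \<exists>z. norm (z - fst q) \<le> e \<and>
      norm (V i z - z - h i *\<^sub>R snd q) \<le> e * h i" if "p \<in> C" for p
  proof -
    have "(fst p, snd p) \<in> generator_limit V h F" using that C(2) by auto
    then have "\<forall>\<^sub>F i in F. \<exists>z. norm (z - fst p) \<le> e / 2 \<and>
        norm (V i z - z - h i *\<^sub>R snd p) \<le> e / 2 * h i"
      using half_gt_zero[OF e] unfolding generator_limit_def mem_Collect_eq prod.case by blast
    with h have "\<forall>\<^sub>F i in F. \<exists>z. 0 \<le> h i \<and> norm (z - fst p) \<le> e / 2 \<and>
        norm (V i z - z - h i *\<^sub>R snd p) \<le> e / 2 * h i"
      by eventually_elim simp
    moreover have "\<forall>\<^sub>F q in nhds p. dist q p < e / 2"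
      using e by (intro tendstoD filterlim_ident) simp
    moreover have "norm (z - fst q) \<le> e \<and> norm (V i z - z - h i *\<^sub>R snd q) \<le> e * h i"
      if "0 \<le> h i \<and> norm (z - fst p) \<le> e / 2 \<and> norm (V i z - z - h i *\<^sub>R snd p) \<le> e / 2 * h i"
        and "dist q p < e / 2" for i q z
      using that generator_limit_approximant_near[of z "fst p" "e / 2" "V i" "h i" "snd p"
          "fst q" "snd q" "e / 2"]
      by simp
    ultimately show ?thesis
      unfolding eventually_prod_filter prod.case by blast
  qed
  from eventually_ball_compact[OF C(1) this] show ?thesis by (simp add: case_prod_beta')
qed

lemma ex_multiple_in_upper_half:
  fixes h b :: real
  assumes "0 < h" "h < b / 4"
  obtains Q :: nat where "0 < Q" "b / 2 \<le> real Q * h" "real Q * h < b"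
proof -
  define Q where "Q = nat \<lceil>b / (2 * h)\<rceil>"
  have "0 < b / (2 * h)" using assms by simp
  then have Q: "real Q < b / (2 * h) + 1" "b / (2 * h) \<le> real Q"
    unfolding Q_def by linarith+
  then have "b / 2 \<le> real Q * h" "real Q * h < b"
    using assms by (auto simp: field_simps)
  moreover have "0 < Q" using \<open>0 < b / (2 * h)\<close> Q(2) by (cases Q) auto
  ultimately show thesis by (rule that[rotated])
qed

context exp_bounded_semigroup
begin

lemma eventually_orbit_increment_near:
  assumes h: "filterlim h (at_right 0) F" and fy: "(f, y) \<in> generator_graph T" and \<eta>: "0 < \<eta>"
  shows "\<forall>\<^sub>F i in F. \<forall>a\<in>{0..b}. norm (T (a + h i) f - T a f - h i *\<^sub>R T a y) \<le> \<eta> * h i"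
proof -
  define K where "K = max 1 (\<bar>M\<bar> * exp (\<bar>w\<bar> * b))"
  have K: "0 < K" by (simp add: K_def)
  have "\<forall>\<^sub>F i in F. dist ((T (h i) f - f) /\<^sub>R h i) y < \<eta> / K"
    using fy \<eta> K by (intro tendstoD[OF filterlim_compose[OF _ h]]) (auto simp: generator_graph_def)
  moreover have "\<forall>\<^sub>F i in F. 0 < h i"
    by (rule eventually_compose_filterlim[OF eventually_at_right_less h])
  ultimately show ?thesis
  proof eventually_elim
    case (elim i)
    have increment: "norm (T (h i) f - f - h i *\<^sub>R y) \<le> \<eta> / K * h i"
      using elim(1) by (simp only: dist_norm less_imp_le flip: norm_quotient_diff_le_iff[OF elim(2)])
    show ?case
    proof
      fix a assume a: "a \<in> {0..b}"
      have "norm (T a) \<le> K"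
        using norm_le_on_interval[OF a] by (simp add: K_def)
      then have "norm (T a (T (h i) f - f - h i *\<^sub>R y)) \<le> K * (\<eta> / K * h i)"
        using increment K by (intro order_trans[OF norm_blinfun] mult_mono) auto
      then show "norm (T (a + h i) f - T a f - h i *\<^sub>R T a y) \<le> \<eta> * h i"
        using a elim(2) K by (simp add: add_apply blinfun.diff_right blinfun.scaleR_right)
    qed
  qed
qed

lemma orbit_approximants:
  assumes gen: "generator_graph T \<subseteq> generator_limit V h F" and h: "filterlim h (at_right 0) F"
    and fy: "(f, y) \<in> generator_graph T" and \<eta>: "0 < \<eta>"
  shows "\<forall>\<^sub>F i in F. \<forall>a\<in>{0..b}. \<exists>z. norm (z - T a f) \<le> \<eta> \<and>
    norm (V i z - z - (T (a + h i) f - T a f)) \<le> \<eta> * h i"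
proof -
  let ?C = "(\<lambda>a. (T a f, T a y)) ` {0..b}"
  have "compact ?C"
    by (intro compact_continuous_image continuous_on_Pair continuous_on_subset[OF orbit_continuous])
      auto
  moreover have "?C \<subseteq> generator_limit V h F"
    using gen generator_orbit[OF fy] by auto
  moreover have "\<forall>\<^sub>F i in F. 0 \<le> h i"
    using eventually_compose_filterlim[OF eventually_at_right_less h] by eventually_elim simp
  ultimately have "\<forall>\<^sub>F i in F. \<forall>(x, y)\<in>?C. \<exists>z.
      norm (z - x) \<le> \<eta> / 2 \<and> norm (V i z - z - h i *\<^sub>R y) \<le> \<eta> / 2 * h i"
    using \<eta> by (intro generator_limit_uniform_on_compact) auto
  with eventually_orbit_increment_near[OF h fy half_gt_zero[OF \<eta>], of b] show ?thesis
  proof eventually_elim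
    case (elim i)
    show ?case
    proof
      fix a assume a: "a \<in> {0..b}"
      then obtain z where z: "norm (z - T a f) \<le> \<eta> / 2"
        "norm (V i z - z - h i *\<^sub>R T a y) \<le> \<eta> / 2 * h i"
        using elim(2) imageI[OF a, of "\<lambda>a. (T a f, T a y)"] by blast
      have "norm (V i z - z - (T (a + h i) f - T a f))
          = norm ((V i z - z - h i *\<^sub>R T a y) - (T (a + h i) f - T a f - h i *\<^sub>R T a y))" by simp
      also have "\<dots> \<le> \<eta> / 2 * h i + \<eta> / 2 * h i"
        using elim(1) a by (intro norm_triangle_le_diff[OF add_mono[OF z(2)]]) blast
      finally show "\<exists>z. norm (z - T a f) \<le> \<eta> \<and> norm (V i z - z - (T (a + h i) f - T a f)) \<le> \<eta> * h i"
        using z(1) \<eta> by (intro exI[of _ z]) simp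
    qed
  qed
qed

lemma norm_blinfun_power_orbit_error_le:
  assumes h: "0 < h" and Q: "0 < Q" and stable: "\<And>k. k \<le> n \<Longrightarrow> norm (blinfun_power V k) \<le> K"
    and orbit_bound: "norm (T (real n * h)) \<le> K"
    and near_zero: "\<And>s. s \<in> {0..real Q * h} \<Longrightarrow> norm (T s f - f) \<le> \<epsilon>"
    and approx: "\<And>a. a \<in> {0..real (n + Q) * h} \<Longrightarrow> \<exists>z. norm (z - T a f) \<le> \<eta> \<and>
      norm (V z - z - (T (a + h) f - T a f)) \<le> \<eta> * h"
  shows "norm (blinfun_power V n f - T (real n * h) f)
    \<le> 2 * K * \<epsilon> + \<eta> * (K + 1 + real n * K * (h + 2 / real Q))"
proof -
  define u where "u k = T (real k * h) f" for k
  define g where "g = moving_average Q u 0"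
  have K: "0 \<le> K" using orbit_bound norm_ge_zero order_trans by blast
  have "\<exists>z. norm (z - u k) \<le> \<eta> \<and> norm (V z - z - (u (Suc k) - u k)) \<le> \<eta> * h" if "k \<le> n + Q" for k
    using approx[of "real k * h"] that h by (simp add: u_def algebra_simps flip: of_nat_add)
  then obtain z where z: "\<And>k. k \<le> n + Q \<Longrightarrow> norm (z k - u k) \<le> \<eta>"
    "\<And>k. k \<le> n + Q \<Longrightarrow> norm (V (z k) - z k - (u (Suc k) - u k)) \<le> \<eta> * h"
    by metis
  have average_error: "norm (blinfun_power V n g - moving_average Q u n)
      \<le> \<eta> * (K + 1 + real n * K * (h + 2 / real Q))"
    unfolding g_def using z by (intro norm_blinfun_power_moving_average_error_le[OF stable Q]) auto
  have shift: "moving_average Q u n = T (real n * h) g"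
    unfolding g_def blinfun_moving_average
    using h by (simp add: moving_average_def u_def add_apply distrib_right)
  have "norm (moving_average Q (\<lambda>k. u k - f) 0) \<le> \<epsilon>"
    using h by (intro norm_moving_average_le[OF Q]) (auto simp: u_def intro!: near_zero)
  moreover have "moving_average Q (\<lambda>_. f) 0 = f"
    using Q by (simp add: moving_average_def sum_constant_scaleR)
  ultimately have g: "norm (g - f) \<le> \<epsilon>" by (simp add: moving_average_diff g_def)
  have powers: "norm (blinfun_power V n (g - f)) \<le> K * \<epsilon>"
    using stable[of n] g K by (intro order_trans[OF norm_blinfun mult_mono]) auto
  have orbit: "norm (T (real n * h) (g - f)) \<le> K * \<epsilon>"
    using orbit_bound g K by (intro order_trans[OF norm_blinfun mult_mono]) auto
  have "blinfun_power V n f - T (real n * h) f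
      = T (real n * h) (g - f) - blinfun_power V n (g - f)
        + (blinfun_power V n g - moving_average Q u n)"
    by (simp add: shift blinfun.diff_right)
  also have "norm \<dots> \<le> K * \<epsilon> + K * \<epsilon> + \<eta> * (K + 1 + real n * K * (h + 2 / real Q))"
    by (intro norm_triangle_le norm_triangle_le_diff add_mono powers orbit average_error)
  finally show ?thesis by simp
qed

lemma norm_blinfun_power_orbit_error_le_small_step:
  assumes h: "0 < h" "h < b / 4" and time: "real n * h \<le> \<tau>"
    and stable: "\<And>k. k \<le> n \<Longrightarrow> norm (blinfun_power V k) \<le> K"
    and orbit_bound: "norm (T (real n * h)) \<le> K"
    and near_zero: "\<And>s. s \<in> {0..<b} \<Longrightarrow> norm (T s f - f) \<le> \<epsilon>"
    and approx: "\<And>a. a \<in> {0..\<tau> + b} \<Longrightarrow> \<exists>z. norm (z - T a f) \<le> \<eta> \<and>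
      norm (V z - z - (T (a + h) f - T a f)) \<le> \<eta> * h"
  shows "norm (blinfun_power V n f - T (real n * h) f)
    \<le> 2 * K * \<epsilon> + \<eta> * (K + 1 + \<tau> * K * (1 + 4 / b))"
proof -
  have K: "0 \<le> K" using orbit_bound norm_ge_zero order_trans by blast
  have "0 \<le> real n * h" using h(1) by simp
  with time have \<tau>: "0 \<le> \<tau>" by simp
  then obtain z where "norm (z - T 0 f) \<le> \<eta>"
    using approx[of 0] h by auto
  then have \<eta>: "0 \<le> \<eta>" by (rule order_trans[OF norm_ge_zero])
  obtain Q where Q: "0 < Q" "b / 2 \<le> real Q * h" "real Q * h < b"
    using h by (rule ex_multiple_in_upper_half)
  have "real n * K * (h + 2 / real Q) = (real n * h) * K * (1 + 2 / (real Q * h))"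
    using Q(1) h(1) by (simp add: field_simps)
  also have "\<dots> \<le> \<tau> * K * (1 + 4 / b)"
    using h time K Q \<tau> by (intro mult_mono add_mono) (auto simp: field_simps)
  finally have "\<eta> * (K + 1 + real n * K * (h + 2 / real Q)) \<le> \<eta> * (K + 1 + \<tau> * K * (1 + 4 / b))"
    using \<eta> by (intro mult_left_mono) auto
  moreover have "norm (blinfun_power V n f - T (real n * h) f)
      \<le> 2 * K * \<epsilon> + \<eta> * (K + 1 + real n * K * (h + 2 / real Q))"
  proof (rule norm_blinfun_power_orbit_error_le[OF h(1) Q(1) stable orbit_bound])
    fix a assume "a \<in> {0..real (n + Q) * h}"
    then show "\<exists>z. norm (z - T a f) \<le> \<eta> \<and> norm (V z - z - (T (a + h) f - T a f)) \<le> \<eta> * h"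
      using time Q(3) by (intro approx) (auto simp: distrib_right)
  qed (use near_zero Q(3) in auto)
  ultimately show ?thesis by linarith
qed

lemma chernoff_tendsto_on_domain:
  assumes h: "filterlim h (at_right 0) F" and time: "\<forall>\<^sub>F i in F. real (n i) * h i \<le> \<tau>"
    and stable: "\<forall>\<^sub>F i in F. \<forall>k\<le>n i. norm (blinfun_power (V i) k) \<le> K"
    and orbit_bound: "\<forall>\<^sub>F i in F. norm (T (real (n i) * h i)) \<le> K" and K: "0 < K"
    and gen: "generator_graph T \<subseteq> generator_limit V h F" and fy: "(f, y) \<in> generator_graph T"
  shows "((\<lambda>i. blinfun_power (V i) (n i) f - T (real (n i) * h i) f) \<longlongrightarrow> 0) F"
proof (rule tendstoI)
  fix e :: real assume e: "0 < e"
  define \<epsilon> where "\<epsilon> = e / (8 * K)"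
  have \<epsilon>: "0 < \<epsilon>" "2 * K * \<epsilon> = e / 4" using e K by (auto simp: \<epsilon>_def)
  obtain b where b: "0 < b" "\<And>s. s \<in> {0..<b} \<Longrightarrow> norm (T s f - f) < \<epsilon>"
    using orbit_near_start[OF \<epsilon>(1), of f] by blast
  define C where "C = K + 1 + \<bar>\<tau>\<bar> * K * (1 + 4 / b)"
  have C: "0 < C" using K b by (auto simp: C_def intro!: add_pos_nonneg)
  define \<eta> where "\<eta> = e / (2 * C)"
  have \<eta>: "0 < \<eta>" "\<eta> * C = e / 2" using e C by (auto simp: \<eta>_def)
  have h_pos: "\<forall>\<^sub>F i in F. 0 < h i"
    by (rule eventually_compose_filterlim[OF eventually_at_right_less h])
  have h_small: "\<forall>\<^sub>F i in F. h i < b / 4"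
    using h b(1) by (intro order_tendstoD(2)[where y = 0]) (auto simp: filterlim_at)
  show "\<forall>\<^sub>F i in F. dist (blinfun_power (V i) (n i) f - T (real (n i) * h i) f) 0 < e"
    using h_pos h_small time stable orbit_bound
      orbit_approximants[OF gen h fy \<eta>(1), where b = "\<bar>\<tau>\<bar> + b"]
  proof eventually_elim
    case (elim i)
    have "norm (blinfun_power (V i) (n i) f - T (real (n i) * h i) f) \<le> 2 * K * \<epsilon> + \<eta> * C"
      unfolding C_def
    proof (rule norm_blinfun_power_orbit_error_le_small_step[OF elim(1,2) _ _ elim(5)])
      show "real (n i) * h i \<le> \<bar>\<tau>\<bar>" using elim(3) by simp
      show "norm (T s f - f) \<le> \<epsilon>" if "s \<in> {0..<b}" for s
        using b(2)[OF that] by simp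
    qed (use elim(4,6) in auto)
    then show ?case using e \<epsilon>(2) \<eta>(2) by simp
  qed
qed

theorem chernoff_tendsto:
  assumes h: "filterlim h (at_right 0) F" and time: "\<forall>\<^sub>F i in F. real (n i) * h i \<le> \<tau>"
    and stable: "\<forall>\<^sub>F i in F. \<forall>k\<le>n i. norm (blinfun_power (V i) k) \<le> K"
    and gen: "generator_graph T \<subseteq> generator_limit V h F"
  shows "((\<lambda>i. blinfun_power (V i) (n i) f - T (real (n i) * h i) f) \<longlongrightarrow> 0) F"
proof -
  define K' where "K' = max 1 (max K (\<bar>M\<bar> * exp (\<bar>w\<bar> * \<tau>)))"
  have "\<forall>\<^sub>F i in F. 0 < h i"
    by (rule eventually_compose_filterlim[OF eventually_at_right_less h])
  with time have orbit_bound: "\<forall>\<^sub>F i in F. norm (T (real (n i) * h i)) \<le> K'"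
    by eventually_elim (rule order_trans[OF norm_le_on_interval[where b = \<tau>]], auto simp: K'_def)
  have powers: "\<forall>\<^sub>F i in F. \<forall>k\<le>n i. norm (blinfun_power (V i) k) \<le> K'"
    using stable by eventually_elim (auto simp: K'_def le_max_iff_disj)
  have "((\<lambda>i. (blinfun_power (V i) (n i) - T (real (n i) * h i)) f) \<longlongrightarrow> 0) F"
  proof (rule strong_tendsto_zero_if_dense[OF _ generator_dense])
    show "\<forall>\<^sub>F i in F. norm (blinfun_power (V i) (n i) - T (real (n i) * h i)) \<le> K' + K'"
      using orbit_bound powers by eventually_elim (intro norm_triangle_le_diff add_mono, auto)
    show "((\<lambda>i. (blinfun_power (V i) (n i) - T (real (n i) * h i)) f) \<longlongrightarrow> 0) F"
      if "f \<in> Domain (generator_graph T)" for f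
      using that chernoff_tendsto_on_domain[OF h time powers orbit_bound _ gen]
      by (auto simp: blinfun.diff_left K'_def)
  qed
  then show ?thesis by (simp add: blinfun.diff_left)
qed

lemma chernoff_uniform_limit_positive_times:
  fixes V :: "real \<Rightarrow> 'a \<Rightarrow>\<^sub>L 'a"
  assumes stable: "\<And>h n. 0 \<le> h \<Longrightarrow> norm (blinfun_power (V h) n) \<le> K * exp (\<omega> * (real n * h))"
    and core: "generator_graph T \<subseteq> closure (op_graph D C)"
    and consistent: "\<And>g. g \<in> D \<Longrightarrow> ((\<lambda>h. (V h g - g) /\<^sub>R h) \<longlongrightarrow> C g) (at_right 0)"
  shows "uniform_limit {0<..\<tau>} (\<lambda>n t. blinfun_power (V (t / real n)) n f) (\<lambda>t. T t f) sequentially"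
proof -
  define F where "F = sequentially \<times>\<^sub>F principal {0<..\<tau>}"
  define h where "h = (\<lambda>(n, t). t / real n)"
  have h: "filterlim h (at_right 0) F"
    unfolding h_def F_def by (rule filterlim_time_step)
  then have h_pos: "\<forall>\<^sub>F p in F. 0 < h p"
    by (rule eventually_compose_filterlim[OF eventually_at_right_less])
  have "\<forall>\<^sub>F (n, t) in F. real n * h (n, t) = t \<and> t \<le> \<tau>"
    unfolding F_def eventually_prod_principal using eventually_gt_at_top[of "0::nat"]
    by eventually_elim (simp add: h_def)
  then have time: "\<forall>\<^sub>F p in F. real (fst p) * h p = snd p \<and> snd p \<le> \<tau>"
    by (simp add: case_prod_beta')
  have gen: "generator_graph T \<subseteq> generator_limit (\<lambda>p. V (h p)) h F"
    using core closure_op_graph_le_generator_limit[OF h consistent] by blast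
  have powers: "\<forall>\<^sub>F p in F. \<forall>k\<le>fst p. norm (blinfun_power (V (h p)) k) \<le> \<bar>K\<bar> * exp (\<bar>\<omega>\<bar> * \<tau>)"
    using h_pos time
  proof eventually_elim
    case (elim p)
    have "real k * h p \<in> {0..\<tau>}" if "k \<le> fst p" for k
      using that elim mult_right_mono[of "real k" "real (fst p)" "h p"] by auto
    then show ?case
      using elim(1) by (auto intro!: order_trans[OF stable exp_growth_le_on_interval])
  qed
  have "\<forall>\<^sub>F p in F. real (fst p) * h p \<le> \<tau>"
    using time by eventually_elim simp
  then have "((\<lambda>p. blinfun_power (V (h p)) (fst p) f - T (real (fst p) * h p) f) \<longlongrightarrow> 0) F"
    by (rule chernoff_tendsto[OF h _ powers gen])
  moreover have "\<forall>\<^sub>F p in F. blinfun_power (V (h p)) (fst p) f - T (real (fst p) * h p) f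
      = (case p of (n, t) \<Rightarrow> blinfun_power (V (t / real n)) n f - T t f)"
    using time by eventually_elim (auto simp: h_def)
  ultimately have "((\<lambda>(n, t). blinfun_power (V (t / real n)) n f - T t f) \<longlongrightarrow> 0) F"
    by (rule Lim_transform_eventually)
  then show ?thesis
    unfolding F_def by (simp add: uniform_limit_iff_tendsto_prod_principal)
qed

theorem chernoff_product_formula:
  fixes V :: "real \<Rightarrow> 'a \<Rightarrow>\<^sub>L 'a"
  assumes zero: "V 0 = id_blinfun"
    and stable: "\<And>h n. 0 \<le> h \<Longrightarrow> norm (blinfun_power (V h) n) \<le> K * exp (\<omega> * (real n * h))"
    and core: "generator_graph T \<subseteq> closure (op_graph D C)"
    and consistent: "\<And>g. g \<in> D \<Longrightarrow> ((\<lambda>h. (V h g - g) /\<^sub>R h) \<longlongrightarrow> C g) (at_right 0)"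
  shows "uniform_limit {0..\<tau>} (\<lambda>n t. blinfun_power (V (t / real n)) n f) (\<lambda>t. T t f) sequentially"
proof -
  have "blinfun_power id_blinfun n f = f" for n
    by (induction n) simp_all
  then have "uniform_limit {0} (\<lambda>n t. blinfun_power (V (t / real n)) n f) (\<lambda>t. T t f) sequentially"
    by (simp add: zero)
  from uniform_limit_on_Un[OF chernoff_uniform_limit_positive_times[OF stable core consistent] this]
  show ?thesis by (rule uniform_limit_on_subset) auto
qed

end

section \<open>Families of semigroups with strongly continuous resolvents\<close>

lemma (in exp_bounded_semigroup) blinfun_power_semigroup:
  assumes "0 \<le> t"
  shows "blinfun_power (T t) n = T (real n * t)"
proof (induction n)
  case 0
  show ?case by (rule blinfun_eqI) simp
next
  case (Suc n)
  then show ?case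
    using assms by (intro blinfun_eqI) (simp add: add_apply[symmetric] algebra_simps)
qed

locale resolvent_continuous_family =
  fixes D :: "'p::topological_space \<Rightarrow> 'a::banach set" and A :: "'p \<Rightarrow> 'a \<Rightarrow> 'a"
    and S :: "'p \<Rightarrow> real \<Rightarrow> 'a \<Rightarrow>\<^sub>L 'a" and M w l :: real
  assumes generates: "generates (D r) (A r) (S r)"
    and family_bound: "0 \<le> t \<Longrightarrow> norm (S r t) \<le> M * exp (w * t)"
    and growth_less: "w < l"
    and resolvent_continuous: "continuous_on UNIV (\<lambda>r. resolvent l (D r) (A r) x)"
begin

sublocale fibre: exp_bounded_semigroup "S r" M w for r
  using generates family_bound by unfold_locales (auto simp: generates_def)

lemma continuous_generator_selection:
  assumes "(x, y) \<in> generator_graph (S s)"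
  obtains \<xi> \<eta> where "\<forall>r. (\<xi> r, \<eta> r) \<in> generator_graph (S r)" "(\<xi> \<longlongrightarrow> x) (nhds s)" "(\<eta> \<longlongrightarrow> y) (nhds s)"
proof -
  define v where "v = l *\<^sub>R x - y"
  define \<xi> where "\<xi> r = resolvent l (D r) (A r) v" for r
  have "\<xi> s = x"
    unfolding \<xi>_def v_def by (rule fibre.resolvent_generator(2)[OF generates growth_less assms])
  moreover have "continuous_on UNIV \<xi>"
    unfolding \<xi>_def by (rule resolvent_continuous)
  then have "(\<xi> \<longlongrightarrow> \<xi> s) (nhds s)"
    using tendsto_at_iff_tendsto_nhds[of \<xi> s] by (simp add: continuous_on_def)
  ultimately have \<xi>: "(\<xi> \<longlongrightarrow> x) (nhds s)" by simp
  have "((\<lambda>r. l *\<^sub>R \<xi> r - v) \<longlongrightarrow> l *\<^sub>R x - v) (nhds s)"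
    by (intro tendsto_intros \<xi>)
  then have "((\<lambda>r. l *\<^sub>R \<xi> r - v) \<longlongrightarrow> y) (nhds s)" by (simp add: v_def)
  with \<xi> show thesis
    using fibre.resolvent_generator(1)[OF generates growth_less]
    by (intro that[of \<xi> "\<lambda>r. l *\<^sub>R \<xi> r - v"]) (auto simp: \<xi>_def)
qed

lemma eventually_fst_in_unit_interval: "\<forall>\<^sub>F p in at_right 0 \<times>\<^sub>F F. fst p \<in> {0<..<1::real}"
  by (rule eventually_compose_filterlim[OF eventually_at_right_real filterlim_fst]) simp

lemma eventually_norm_le:
  "\<forall>\<^sub>F p in at_right 0 \<times>\<^sub>F nhds s. norm (S (snd p) (fst p)) \<le> \<bar>M\<bar> * exp (\<bar>w\<bar> * 1)"
  using eventually_fst_in_unit_interval by eventually_elim (rule fibre.norm_le_on_interval, auto)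

lemma increment_along_generator_tendsto_zero:
  assumes gen: "\<forall>r. (\<xi> r, \<eta> r) \<in> generator_graph (S r)" and \<eta>: "(\<eta> \<longlongrightarrow> y) (nhds s)"
  shows "((\<lambda>p. S (snd p) (fst p) (\<xi> (snd p)) - \<xi> (snd p)) \<longlongrightarrow> 0) (at_right 0 \<times>\<^sub>F nhds s)"
proof -
  define G where "G = at_right (0::real) \<times>\<^sub>F nhds s"
  define K where "K = \<bar>M\<bar> * exp (\<bar>w\<bar> * 1)"
  have "(fst \<longlongrightarrow> 0) G"
    using filterlim_fst[of "at_right (0::real)" "nhds s"] by (simp add: G_def filterlim_at)
  moreover have "((\<lambda>p. \<eta> (snd p)) \<longlongrightarrow> y) G"
    unfolding G_def by (rule filterlim_compose[OF \<eta> filterlim_snd])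
  ultimately have "((\<lambda>p. K * norm (\<eta> (snd p)) * fst p) \<longlongrightarrow> K * norm y * 0) G"
    by (intro tendsto_intros)
  then have lim: "((\<lambda>p. K * norm (\<eta> (snd p)) * fst p) \<longlongrightarrow> 0) G" by simp
  have "\<forall>\<^sub>F p in G. norm (S (snd p) (fst p) (\<xi> (snd p)) - \<xi> (snd p)) \<le> K * norm (\<eta> (snd p)) * fst p"
    using eventually_fst_in_unit_interval unfolding G_def
  proof eventually_elim
    case (elim p)
    have "norm (S (snd p) t (\<eta> (snd p)) - 0) \<le> K * norm (\<eta> (snd p))" if "t \<in> {0..fst p}" for t
      using fibre.norm_apply_le_on_interval[of t 1] that elim by (simp add: K_def)
    then have "norm (S (snd p) (fst p) (\<xi> (snd p)) - \<xi> (snd p) - fst p *\<^sub>R 0)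
        \<le> K * norm (\<eta> (snd p)) * fst p"
      using elim by (intro fibre.orbit_increment_le[OF gen[rule_format]]) auto
    then show ?case by simp
  qed
  then show ?thesis
    unfolding G_def[symmetric] by (rule Lim_null_comparison[OF _ lim])
qed

lemma tendsto_identity: "((\<lambda>(t, r). S r t x) \<longlongrightarrow> x) (at_right 0 \<times>\<^sub>F nhds s)"
proof -
  define G where "G = at_right (0::real) \<times>\<^sub>F nhds s"
  define L where "L p = S (snd p) (fst p) - id_blinfun" for p
  have L_bound: "\<forall>\<^sub>F p in G. norm (L p) \<le> \<bar>M\<bar> * exp (\<bar>w\<bar> * 1) + 1"
    using eventually_norm_le unfolding G_def
    by eventually_elim (auto simp: L_def intro!: norm_triangle_le_diff add_mono norm_blinfun_id_le)
  have "((\<lambda>p. L p x) \<longlongrightarrow> 0) G"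
  proof (rule strong_tendsto_zero_if_dense[OF L_bound fibre.generator_dense[of s]])
    fix x assume "x \<in> Domain (generator_graph (S s))"
    then obtain y where "(x, y) \<in> generator_graph (S s)" by blast
    then obtain \<xi> \<eta> where gen: "\<forall>r. (\<xi> r, \<eta> r) \<in> generator_graph (S r)"
      and \<xi>: "(\<xi> \<longlongrightarrow> x) (nhds s)" and \<eta>: "(\<eta> \<longlongrightarrow> y) (nhds s)"
      by (rule continuous_generator_selection)
    have "((\<lambda>p. x - \<xi> (snd p)) \<longlongrightarrow> x - x) G"
      unfolding G_def by (intro tendsto_diff tendsto_const filterlim_compose[OF \<xi> filterlim_snd])
    then have "((\<lambda>p. L p (x - \<xi> (snd p))) \<longlongrightarrow> 0) G"
      by (intro tendsto_blinfun_apply_equibounded[OF L_bound, where x = 0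
            and u = "\<lambda>p. x - \<xi> (snd p)"]) simp_all
    moreover have "((\<lambda>p. L p (\<xi> (snd p))) \<longlongrightarrow> 0) G"
      using increment_along_generator_tendsto_zero[OF gen \<eta>]
      by (simp add: L_def G_def blinfun.diff_left)
    ultimately have "((\<lambda>p. L p (x - \<xi> (snd p)) + L p (\<xi> (snd p))) \<longlongrightarrow> 0 + 0) G"
      by (rule tendsto_add)
    then show "((\<lambda>p. L p x) \<longlongrightarrow> 0) G" by (simp add: blinfun.diff_right)
  qed
  then have "((\<lambda>p. S (snd p) (fst p) x) \<longlongrightarrow> x) G"
    unfolding L_def by (simp add: blinfun.diff_left Lim_null[symmetric])
  then show ?thesis by (simp add: G_def case_prod_beta')
qed

lemma difference_quotient_tendsto:
  assumes gen: "\<forall>r. (\<xi> r, \<eta> r) \<in> generator_graph (S r)" and \<eta>: "(\<eta> \<longlongrightarrow> y) (nhds s)"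
  shows "((\<lambda>(h, r). (S r h (\<xi> r) - \<xi> r) /\<^sub>R h) \<longlongrightarrow> y) (at_right 0 \<times>\<^sub>F nhds s)"
proof (rule tendstoI)
  fix e :: real assume e: "0 < e"
  have "((\<lambda>p. S (snd p) (fst p) y) \<longlongrightarrow> y) (at_right 0 \<times>\<^sub>F nhds s)"
    using tendsto_identity by (simp add: case_prod_beta')
  then have "((\<lambda>p. S (snd p) (fst p) (\<eta> (snd p))) \<longlongrightarrow> y) (at_right 0 \<times>\<^sub>F nhds s)"
    by (rule tendsto_blinfun_apply_equibounded[OF eventually_norm_le _
          filterlim_compose[OF \<eta> filterlim_snd]])
  then have "\<forall>\<^sub>F p in at_right 0 \<times>\<^sub>F nhds s. dist (S (snd p) (fst p) (\<eta> (snd p))) y < e / 2"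
    using e by (intro tendstoD) auto
  then obtain P Q where P: "eventually P (at_right (0::real))" and Q: "eventually Q (nhds s)"
    and PQ: "\<And>t r. P t \<Longrightarrow> Q r \<Longrightarrow> dist (S r t (\<eta> r)) y < e / 2"
    unfolding eventually_prod_filter by auto
  obtain d where d: "0 < d" "\<And>t. 0 < t \<Longrightarrow> t < d \<Longrightarrow> P t"
    using P by (auto simp: eventually_at_right_field)
  have "\<forall>\<^sub>F h in at_right (0::real). h \<in> {0<..<d}"
    using d(1) by (rule eventually_at_right_real)
  moreover have "\<forall>\<^sub>F r in nhds s. Q r \<and> dist (\<eta> r) y < e / 2"
    using Q e by (intro eventually_conj tendstoD[OF \<eta>]) auto
  ultimately show "\<forall>\<^sub>F p in at_right 0 \<times>\<^sub>F nhds s.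
      dist (case p of (h, r) \<Rightarrow> (S r h (\<xi> r) - \<xi> r) /\<^sub>R h) y < e"
    unfolding eventually_prod_filter
  proof (intro exI conjI allI impI)
    fix h r assume h: "h \<in> {0<..<d}" and r: "Q r \<and> dist (\<eta> r) y < e / 2"
    have "norm (S r t (\<eta> r) - y) \<le> e / 2" if "t \<in> {0..h}" for t
      using that h r d(2)[of t] PQ[of t r] by (cases "t = 0") (auto simp: dist_norm)
    then have "norm (S r h (\<xi> r) - \<xi> r - h *\<^sub>R y) \<le> e / 2 * h"
      using h by (intro fibre.orbit_increment_le[OF gen[rule_format]]) auto
    then have "norm ((S r h (\<xi> r) - \<xi> r) /\<^sub>R h - y) \<le> e / 2"
      using h by (subst norm_quotient_diff_le_iff) auto
    then show "dist (case (h, r) of (h, r) \<Rightarrow> (S r h (\<xi> r) - \<xi> r) /\<^sub>R h) y < e"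
      using e by (simp add: dist_norm)
  qed
qed

lemma generator_graph_le_generator_limit:
  assumes h: "filterlim h (at_right 0) (F \<times>\<^sub>F nhds s)"
  shows "generator_graph (S s) \<subseteq> generator_limit (\<lambda>p. S (snd p) (h p)) h (F \<times>\<^sub>F nhds s)"
proof clarify
  fix x y assume "(x, y) \<in> generator_graph (S s)"
  then obtain \<xi> \<eta> where gen: "\<forall>r. (\<xi> r, \<eta> r) \<in> generator_graph (S r)"
    and \<xi>: "(\<xi> \<longlongrightarrow> x) (nhds s)" and \<eta>: "(\<eta> \<longlongrightarrow> y) (nhds s)"
    by (rule continuous_generator_selection)
  have "filterlim (\<lambda>p. (h p, snd p)) (at_right 0 \<times>\<^sub>F nhds s) (F \<times>\<^sub>F nhds s)"
    by (intro filterlim_Pair filterlim_snd h)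
  from filterlim_compose[OF difference_quotient_tendsto[OF gen \<eta>] this]
  have "((\<lambda>p. (S (snd p) (h p) (\<xi> (snd p)) - \<xi> (snd p)) /\<^sub>R h p) \<longlongrightarrow> y) (F \<times>\<^sub>F nhds s)" by simp
  with eventually_compose_filterlim[OF eventually_at_right_less h] filterlim_compose[OF \<xi> filterlim_snd]
  show "(x, y) \<in> generator_limit (\<lambda>p. S (snd p) (h p)) h (F \<times>\<^sub>F nhds s)"
    by (rule generator_limitI)
qed

text \<open>Chernoff's formula for the steps \<open>S r (t / n)\<close>, whose \<open>n\<close>-th powers do not depend on \<open>n\<close>,
  is the Trotter-Kato theorem.\<close>

theorem strongly_continuous_parameter:
  assumes t: "0 \<le> t"
  shows "continuous_on UNIV (\<lambda>r. S r t x)"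
proof (cases "t = 0")
  case False
  have "((\<lambda>r. S r t x - S s t x) \<longlongrightarrow> 0) (nhds s)" for s
  proof -
    define F where "F = sequentially \<times>\<^sub>F nhds s"
    define h where "h p = t / real (fst p)" for p :: "nat \<times> 'p"
    have "\<forall>\<^sub>F p in F. 0 < fst p"
      unfolding F_def by (rule eventually_compose_filterlim[OF eventually_gt_at_top filterlim_fst])
    then have time: "\<forall>\<^sub>F p in F. 0 < h p \<and> real (fst p) * h p = t"
      by eventually_elim (use t False in \<open>simp add: h_def\<close>)
    have "(h \<longlongrightarrow> 0) F"
      unfolding h_def F_def by (rule filterlim_compose[OF lim_const_over_n filterlim_fst])
    then have h: "filterlim h (at_right 0) F"
      using time by (intro tendsto_imp_filterlim_at_right) (auto elim: eventually_mono)
    have "\<forall>\<^sub>F p in F. \<forall>k\<le>fst p. norm (blinfun_power (S (snd p) (h p)) k) \<le> \<bar>M\<bar> * exp (\<bar>w\<bar> * t)"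
      using time
    proof eventually_elim
      case (elim p)
      have "real k * h p \<in> {0..t}" if "k \<le> fst p" for k
        using that elim mult_right_mono[of "real k" "real (fst p)" "h p"] by auto
      then show ?case
        using elim by (auto simp: fibre.blinfun_power_semigroup intro!: fibre.norm_le_on_interval)
    qed
    moreover have "generator_graph (S s) \<subseteq> generator_limit (\<lambda>p. S (snd p) (h p)) h F"
      using h unfolding F_def by (rule generator_graph_le_generator_limit)
    ultimately have "((\<lambda>p. blinfun_power (S (snd p) (h p)) (fst p) x
        - S s (real (fst p) * h p) x) \<longlongrightarrow> 0) F"
      using time by (intro fibre.chernoff_tendsto[OF h, where \<tau> = t]) (auto elim: eventually_mono)
    moreover have "\<forall>\<^sub>F p in F. blinfun_power (S (snd p) (h p)) (fst p) x - S s (real (fst p) * h p) x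
        = (case p of (n, r) \<Rightarrow> S r t x - S s t x)"
      using time by eventually_elim (auto simp: fibre.blinfun_power_semigroup)
    ultimately have "((\<lambda>(n, r). S r t x - S s t x) \<longlongrightarrow> 0) F"
      by (rule Lim_transform_eventually)
    then show ?thesis
      unfolding F_def case_prod_beta' by (subst (asm) tendsto_compose_snd_iff) simp_all
  qed
  then have "((\<lambda>r. S r t x) \<longlongrightarrow> S s t x) (nhds s)" for s
    by (rule Lim_null[THEN iffD2])
  then show ?thesis
    unfolding continuous_on_def by (blast intro: tendsto_mono[OF at_within_le_nhds])
qed simp

end

section \<open>Uniform convergence in the space of functions vanishing at infinity\<close>

lemma tendsto_c0_iff:
  "(f \<longlongrightarrow> l) F \<longleftrightarrow> uniform_limit UNIV (\<lambda>i. apply_c0 (f i)) (apply_c0 l) F"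
proof
  have apply_le: "dist (apply_c0 g s) (apply_c0 h s) \<le> dist g h" for g h :: "'b c0" and s
    using norm_apply_c0_le[of "g - h" s] by (simp add: dist_norm)
  assume "(f \<longlongrightarrow> l) F"
  then show "uniform_limit UNIV (\<lambda>i. apply_c0 (f i)) (apply_c0 l) F"
    using le_less_trans[OF apply_le]
    by (auto intro!: uniform_limitI elim!: eventually_mono dest!: tendstoD)
next
  assume lim: "uniform_limit UNIV (\<lambda>i. apply_c0 (f i)) (apply_c0 l) F"
  show "(f \<longlongrightarrow> l) F"
  proof (rule tendstoI)
    fix e :: real assume e: "0 < e"
    then have "\<forall>\<^sub>F i in F. \<forall>s\<in>UNIV. dist (f i s) (l s) < e / 2"
      by (intro uniform_limitD[OF lim]) simp
    then show "\<forall>\<^sub>F i in F. dist (f i) l < e"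
    proof eventually_elim
      case (elim i)
      then have "norm (f i - l) \<le> e / 2"
        by (intro norm_c0_leI) (simp add: dist_norm less_imp_le)
      then show ?case using e by (simp add: dist_norm)
    qed
  qed
qed

lemma c0_tendsto_nhds: "(apply_c0 f \<longlongrightarrow> f s) (nhds s)"
  using apply_c0[of f] tendsto_at_iff_tendsto_nhds[of f s] by (simp add: C0_def continuous_on_def)

lemma c0_tendsto_at_infinity: "(apply_c0 f \<longlongrightarrow> 0) at_infinity"
  using apply_c0[of f] by (simp add: C0_def)

lemma uniform_limit_weighted_shift:
  fixes L :: "'i \<Rightarrow> real \<Rightarrow> 'a::real_normed_vector \<Rightarrow>\<^sub>L 'a" and f :: "'a c0"
  assumes bound: "\<forall>\<^sub>F i in F. \<forall>r. norm (L i r) \<le> K"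
    and local: "\<And>s x. ((\<lambda>(i, r). L i r x) \<longlongrightarrow> x) (F \<times>\<^sub>F nhds s)"
    and shift: "(c \<longlongrightarrow> 0) F"
  shows "uniform_limit UNIV (\<lambda>i r. L i r (f (r - c i))) f F"
proof -
  have product_bound: "\<forall>\<^sub>F p in F \<times>\<^sub>F G. norm (L (fst p) (snd p)) \<le> K" for G
    using eventually_compose_filterlim[OF bound filterlim_fst] by eventually_elim blast
  have product_shift: "((\<lambda>p. c (fst p)) \<longlongrightarrow> 0) (F \<times>\<^sub>F G)" for G
    by (rule filterlim_compose[OF shift filterlim_fst])
  have "((\<lambda>p. L (fst p) (snd p) (f (snd p - c (fst p))) - f (snd p)) \<longlongrightarrow> 0) (F \<times>\<^sub>F nhds s)" for s
  proof -
    have "((\<lambda>p. snd p - c (fst p)) \<longlongrightarrow> s - 0) (F \<times>\<^sub>F nhds s)"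
      by (intro tendsto_diff product_shift filterlim_snd)
    then have "((\<lambda>p. f (snd p - c (fst p))) \<longlongrightarrow> f s) (F \<times>\<^sub>F nhds s)"
      by (intro filterlim_compose[OF c0_tendsto_nhds]) simp
    moreover have "((\<lambda>p. L (fst p) (snd p) (f s)) \<longlongrightarrow> f s) (F \<times>\<^sub>F nhds s)"
      using local by (simp add: case_prod_beta')
    ultimately have "((\<lambda>p. L (fst p) (snd p) (f (snd p - c (fst p)))) \<longlongrightarrow> f s) (F \<times>\<^sub>F nhds s)"
      by (rule tendsto_blinfun_apply_equibounded[OF product_bound, rotated])
    from tendsto_diff[OF this filterlim_compose[OF c0_tendsto_nhds filterlim_snd], of f]
    show ?thesis by simp
  qed
  moreover have "((\<lambda>p. L (fst p) (snd p) (f (snd p - c (fst p))) - f (snd p)) \<longlongrightarrow> 0) (F \<times>\<^sub>F at_infinity)"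
  proof -
    have "((\<lambda>p. - c (fst p)) \<longlongrightarrow> - 0) (F \<times>\<^sub>F at_infinity)"
      by (intro tendsto_minus product_shift)
    from tendsto_add_filterlim_at_infinity'[OF filterlim_snd this]
    have "((\<lambda>p. f (snd p - c (fst p))) \<longlongrightarrow> 0) (F \<times>\<^sub>F at_infinity)"
      by (intro filterlim_compose[OF c0_tendsto_at_infinity]) simp
    then have "((\<lambda>p. L (fst p) (snd p) (f (snd p - c (fst p)))) \<longlongrightarrow> 0) (F \<times>\<^sub>F at_infinity)"
      by (rule tendsto_blinfun_apply_equibounded[OF product_bound, rotated]) simp
    from tendsto_diff[OF this filterlim_compose[OF c0_tendsto_at_infinity filterlim_snd], of f]
    show ?thesis by simp
  qed
  ultimately have "uniform_limit UNIV (\<lambda>i r. L i r (f (r - c i)) - f r) (\<lambda>_. 0) F"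
    by (intro uniform_limit_UNIV_zeroI) (simp_all add: case_prod_beta')
  then show ?thesis by (simp add: uniform_limit_iff dist_norm)
qed

section \<open>Evolution semigroups and translations\<close>

lemma evolution_family_tendsto_identity:
  fixes U :: "real \<Rightarrow> real \<Rightarrow> 'a::real_normed_vector \<Rightarrow>\<^sub>L 'a"
  assumes U: "evolution_family U"
  shows "((\<lambda>(h, s). U s (s - h) x) \<longlongrightarrow> x) (at_right 0 \<times>\<^sub>F nhds s)"
proof -
  let ?F = "at_right (0::real) \<times>\<^sub>F nhds s"
  have cont: "continuous_on {(t, s). s \<le> t} (\<lambda>(t, s). U t s x)" and id: "U s s = id_blinfun"
    using U by (auto simp: evolution_family_def)
  have "(fst \<longlongrightarrow> 0) ?F" and pos: "\<forall>\<^sub>F p in ?F. 0 < fst p"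
    using filterlim_fst[of "at_right (0::real)" "nhds s"]
    by (auto simp: filterlim_at elim: eventually_mono)
  then have "((\<lambda>p. (snd p, snd p - fst p)) \<longlongrightarrow> (s, s - 0)) ?F"
    by (intro tendsto_intros filterlim_snd)
  then have "((\<lambda>p. case (snd p, snd p - fst p) of (t, s) \<Rightarrow> U t s x)
      \<longlongrightarrow> (case (s, s) of (t, s) \<Rightarrow> U t s x)) ?F"
    using pos by (intro continuous_on_tendsto_compose[OF cont]) (auto elim: eventually_mono)
  then show ?thesis by (simp add: id case_prod_beta')
qed

lemma norm_evolution_semigroup_le:
  assumes U: "evolution_family U" and "0 \<le> t" and bound: "\<And>s. norm (U s (s - t)) \<le> K"
  shows "norm (evolution_semigroup U t) \<le> K"
proof (rule norm_blinfun_bound)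
  show K: "0 \<le> K" using bound norm_ge_zero order_trans by blast
  fix f
  show "norm (evolution_semigroup U t f) \<le> K * norm f"
  proof (rule norm_c0_leI)
    fix s
    have "norm (U s (s - t) (f (s - t))) \<le> K * norm f"
      by (rule order_trans[OF norm_blinfun mult_mono[OF bound norm_apply_c0_le K norm_ge_zero]])
    then show "norm (evolution_semigroup U t f s) \<le> K * norm f"
      by (simp add: evolution_semigroup_apply[OF U \<open>0 \<le> t\<close>])
  qed
qed

lemma evolution_semigroup_exp_bounded:
  fixes U :: "real \<Rightarrow> real \<Rightarrow> 'a::banach \<Rightarrow>\<^sub>L 'a"
  assumes U: "evolution_family U" and U_bound: "\<And>t s. s \<le> t \<Longrightarrow> norm (U t s) \<le> M * exp (w * (t - s))"
  shows "exp_bounded_semigroup (evolution_semigroup U) M w"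
proof
  show bound: "norm (evolution_semigroup U t) \<le> M * exp (w * t)" if "0 \<le> t" for t
  proof (rule norm_evolution_semigroup_le[OF U that])
    show "norm (U s (s - t)) \<le> M * exp (w * t)" for s
      using U_bound[of "s - t" s] that by simp
  qed
  have cocycle: "U t r (U r s x) = U t s x" if "s \<le> r" "r \<le> t" for t r s x
    using U that unfolding evolution_family_def by (metis blinfun_apply_blinfun_compose)
  note app = evolution_semigroup_apply[OF U]
  show "C0_semigroup (evolution_semigroup U)"
  proof (rule C0_semigroupI[OF _ _ bound])
    show "evolution_semigroup U 0 = id_blinfun"
      using U by (intro blinfun_eqI c0_eqI) (simp add: app evolution_family_def)
    show "evolution_semigroup U (s + t) = evolution_semigroup U s o\<^sub>L evolution_semigroup U t"
      if "0 \<le> s" "0 \<le> t" for s t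
      using that by (intro blinfun_eqI c0_eqI) (simp add: app cocycle diff_diff_eq)
  next
    fix f :: "'a c0"
    have unit: "\<forall>\<^sub>F h in at_right (0::real). h \<in> {0<..<1}"
      by (rule eventually_at_right_real) simp
    then have "\<forall>\<^sub>F h in at_right 0. \<forall>s. norm (U s (s - h)) \<le> \<bar>M\<bar> * exp (\<bar>w\<bar> * 1)"
    proof eventually_elim
      case (elim h)
      then have "M * exp (w * h) \<le> \<bar>M\<bar> * exp (\<bar>w\<bar> * 1)"
        by (intro exp_growth_le_on_interval) simp
      moreover have "norm (U s (s - h)) \<le> M * exp (w * h)" for s
        using U_bound[of "s - h" s] elim by simp
      ultimately show ?case using order_trans by blast
    qed
    then have "uniform_limit UNIV (\<lambda>h s. U s (s - h) (f (s - h))) f (at_right 0)"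
      by (rule uniform_limit_weighted_shift[OF _ evolution_family_tendsto_identity[OF U]
            tendsto_ident_at])
    moreover have "\<forall>\<^sub>F h in at_right 0. \<forall>s\<in>UNIV. U s (s - h) (f (s - h)) = evolution_semigroup U h f s"
      using unit by eventually_elim (simp add: app)
    ultimately show "((\<lambda>h. evolution_semigroup U h f) \<longlongrightarrow> f) (at_right 0)"
      unfolding tendsto_c0_iff by (simp cong: uniform_limit_cong)
  qed
qed

abbreviation translation :: "real \<Rightarrow> 'a::real_normed_vector c0 \<Rightarrow>\<^sub>L 'a c0" where
  "translation \<equiv> evolution_semigroup (\<lambda>_ _. id_blinfun)"

lemma evolution_family_id: "evolution_family (\<lambda>_ _. id_blinfun :: 'a::real_normed_vector \<Rightarrow>\<^sub>L 'a)"
  unfolding evolution_family_def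
  by (intro conjI allI impI exI[of _ 1] exI[of _ 0])
    (auto intro!: blinfun_eqI norm_blinfun_id_le simp: case_prod_beta')

lemma translation_apply: "0 \<le> h \<Longrightarrow> translation h f s = f (s - h)"
  by (simp add: evolution_semigroup_apply[OF evolution_family_id])

lemma translation_exp_bounded:
  "exp_bounded_semigroup (translation :: real \<Rightarrow> 'a::banach c0 \<Rightarrow>\<^sub>L 'a c0) 1 0"
  by (rule evolution_semigroup_exp_bounded[OF evolution_family_id]) (simp add: norm_blinfun_id_le)

lemma deriv_op_apply: "f \<in> deriv_dom \<Longrightarrow> deriv_op f s = vector_derivative f (at s)"
  by (simp add: deriv_op_def deriv_dom_def apply_Abs_c0)

lemma deriv_op_has_vector_derivative:
  "f \<in> deriv_dom \<Longrightarrow> (apply_c0 f has_vector_derivative deriv_op f s) (at s)"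
  by (simp add: deriv_op_apply vector_derivative_works[symmetric]) (simp add: deriv_dom_def)

lemma deriv_op_in_translation_generator:
  fixes f :: "'a::banach c0"
  assumes f: "f \<in> deriv_dom"
  shows "(f, - deriv_op f) \<in> generator_graph translation"
proof (rule exp_bounded_semigroup.generator_graphI[OF translation_exp_bounded])
  fix h e :: real
  assume h: "0 < h"
    and near: "\<And>r. r \<in> {0..h} \<Longrightarrow> norm (translation r (- deriv_op f) - (- deriv_op f)) \<le> e"
  have deriv: "norm (deriv_op f q - deriv_op f s) \<le> e" if "q \<in> {s - h..s}" for q s
    using order_trans[OF norm_apply_c0_le[of _ s] near[of "s - q"]] that
    by (simp add: translation_apply norm_minus_commute)
  show "norm (translation h f - f - h *\<^sub>R (- deriv_op f)) \<le> e * h"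
  proof (rule norm_c0_leI)
    fix s
    have "norm (f (s - h) - f s - ((s - h) - s) *\<^sub>R deriv_op f s) \<le> norm ((s - h) - s) * e"
    proof (rule vector_differentiable_bound_linearization[where S = "{s - h..s}"])
      show "(apply_c0 f has_vector_derivative deriv_op f q) (at q within {s - h..s})" for q
        by (rule has_vector_derivative_at_within[OF deriv_op_has_vector_derivative[OF f]])
    qed (use h deriv in \<open>auto simp: closed_segment_eq_real_ivl\<close>)
    then show "norm ((translation h f - f - h *\<^sub>R (- deriv_op f)) s) \<le> e * h"
      using h by (simp add: translation_apply mult.commute)
  qed
qed

section \<open>Multiplication semigroups\<close>

definition mult_blinfun :: "(real \<Rightarrow> 'a::real_normed_vector \<Rightarrow>\<^sub>L 'a) \<Rightarrow> 'a c0 \<Rightarrow>\<^sub>L 'a c0" where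
  "mult_blinfun L = Blinfun (\<lambda>f. Abs_c0 (\<lambda>s. L s (apply_c0 f s)))"

lemma C0_mult:
  fixes L :: "real \<Rightarrow> 'a::real_normed_vector \<Rightarrow>\<^sub>L 'a"
  assumes bound: "\<And>s. norm (L s) \<le> K" and cont: "\<And>x. continuous_on UNIV (\<lambda>s. L s x)" and f: "f \<in> C0"
  shows "(\<lambda>s. L s (f s)) \<in> C0"
proof -
  have "((\<lambda>s. L s (f s)) \<longlongrightarrow> L a (f a)) (at a)" for a
    using bound cont f unfolding C0_def continuous_on_def
    by (intro tendsto_blinfun_apply_equibounded[where x = "f a" and L = L and u = f and K = K]) auto
  then have "continuous_on UNIV (\<lambda>s. L s (f s))"
    by (simp add: continuous_on_def)
  moreover have "((\<lambda>s. L s (f s)) \<longlongrightarrow> 0) at_infinity"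
    using bound f
    by (intro tendsto_blinfun_apply_equibounded[where x = 0 and L = L and u = f and K = K])
      (auto simp: C0_def)
  ultimately show ?thesis by (simp add: C0_def)
qed

lemma
  fixes L :: "real \<Rightarrow> 'a::real_normed_vector \<Rightarrow>\<^sub>L 'a"
  assumes bound: "\<And>s. norm (L s) \<le> K" and cont: "\<And>x. continuous_on UNIV (\<lambda>s. L s x)"
  shows mult_blinfun_apply: "mult_blinfun L f s = L s (f s)"
    and norm_mult_blinfun_le: "norm (mult_blinfun L) \<le> K"
proof -
  have K: "0 \<le> K" using bound norm_ge_zero order_trans by blast
  have le: "norm (L s (f s)) \<le> K * norm f" for f :: "'a c0" and s
    by (rule order_trans[OF norm_blinfun mult_mono[OF bound norm_apply_c0_le K norm_ge_zero]])
  note app = apply_Abs_c0[OF C0_mult[OF bound cont apply_c0]]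
  have "bounded_linear (\<lambda>f. Abs_c0 (\<lambda>s. L s (apply_c0 f s)))"
  proof (rule bounded_linear_intro)
    show "norm (Abs_c0 (\<lambda>s. L s (apply_c0 f s))) \<le> norm f * K" for f
      by (rule norm_c0_leI) (simp add: app le mult.commute)
    show "Abs_c0 (\<lambda>s. L s (apply_c0 (f + g) s)) =
        Abs_c0 (\<lambda>s. L s (apply_c0 f s)) + Abs_c0 (\<lambda>s. L s (apply_c0 g s))" for f g
      by (rule c0_eqI) (simp only: app[of "f + g"], simp add: app blinfun.add_right)
    show "Abs_c0 (\<lambda>s. L s (apply_c0 (c *\<^sub>R f) s)) = c *\<^sub>R Abs_c0 (\<lambda>s. L s (apply_c0 f s))" for c f
      by (rule c0_eqI) (simp only: app[of "c *\<^sub>R f"], simp add: app blinfun.scaleR_right)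
  qed
  then show mult_apply: "mult_blinfun L f s = L s (f s)" for f s
    by (simp add: mult_blinfun_def bounded_linear_Blinfun_apply app)
  show "norm (mult_blinfun L) \<le> K"
    using K le by (intro norm_blinfun_bound norm_c0_leI) (auto simp: mult_apply)
qed

lemma mult_op_apply: "f \<in> mult_dom D A \<Longrightarrow> mult_op A f s = A s (f s)"
  by (simp add: mult_op_def mult_dom_def apply_Abs_c0)

locale multiplication_semigroup = resolvent_continuous_family D A S M w l
  for D :: "real \<Rightarrow> 'a::banach set" and A S M w l
begin

definition mult_semigroup :: "real \<Rightarrow> 'a c0 \<Rightarrow>\<^sub>L 'a c0" where
  "mult_semigroup t = mult_blinfun (\<lambda>r. S r t)"

lemma mult_semigroup_apply: "0 \<le> t \<Longrightarrow> mult_semigroup t f r = S r t (f r)"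
  unfolding mult_semigroup_def by (rule mult_blinfun_apply[OF family_bound strongly_continuous_parameter])

sublocale mult: exp_bounded_semigroup mult_semigroup M w
proof
  show bound: "norm (mult_semigroup t) \<le> M * exp (w * t)" if "0 \<le> t" for t
    unfolding mult_semigroup_def
    by (rule norm_mult_blinfun_le[OF family_bound[OF that] strongly_continuous_parameter[OF that]])
  show "C0_semigroup mult_semigroup"
  proof (rule C0_semigroupI[OF _ _ bound])
    show "mult_semigroup 0 = id_blinfun"
      by (intro blinfun_eqI c0_eqI) (simp add: mult_semigroup_apply)
    show "mult_semigroup (s + t) = mult_semigroup s o\<^sub>L mult_semigroup t" if "0 \<le> s" "0 \<le> t" for s t
      using that by (intro blinfun_eqI c0_eqI) (simp add: mult_semigroup_apply fibre.add_apply)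
  next
    fix f :: "'a c0"
    have unit: "\<forall>\<^sub>F h in at_right (0::real). h \<in> {0<..<1}"
      by (rule eventually_at_right_real) simp
    then have "\<forall>\<^sub>F h in at_right 0. \<forall>r. norm (S r h) \<le> \<bar>M\<bar> * exp (\<bar>w\<bar> * 1)"
      by eventually_elim (intro allI fibre.norm_le_on_interval, auto)
    then have "uniform_limit UNIV (\<lambda>h r. S r h (f (r - 0))) f (at_right 0)"
      by (rule uniform_limit_weighted_shift[OF _ tendsto_identity tendsto_const])
    moreover have "\<forall>\<^sub>F h in at_right 0. \<forall>r\<in>UNIV. S r h (f (r - 0)) = mult_semigroup h f r"
      using unit by eventually_elim (simp add: mult_semigroup_apply)
    ultimately show "((\<lambda>h. mult_semigroup h f) \<longlongrightarrow> f) (at_right 0)"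
      unfolding tendsto_c0_iff by (simp cong: uniform_limit_cong)
  qed
qed

lemma mult_op_in_generator:
  assumes f: "f \<in> mult_dom D A"
  shows "(f, mult_op A f) \<in> generator_graph mult_semigroup"
proof (rule mult.generator_graphI)
  fix h e :: real
  assume h: "0 < h"
    and near: "\<And>t. t \<in> {0..h} \<Longrightarrow> norm (mult_semigroup t (mult_op A f) - mult_op A f) \<le> e"
  show "norm (mult_semigroup h f - f - h *\<^sub>R mult_op A f) \<le> e * h"
  proof (rule norm_c0_leI)
    fix r
    have "(f r, mult_op A f r) \<in> op_graph (D r) (A r)"
      using f by (auto simp: mult_op_apply[OF f] op_graph_def mult_dom_def)
    then have "(f r, mult_op A f r) \<in> generator_graph (S r)"
      using generates[of r] by (simp add: generates_def)
    moreover have "norm (S r t (mult_op A f r) - mult_op A f r) \<le> e" if "t \<in> {0..h}" for t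
      using order_trans[OF norm_apply_c0_le[of _ r] near[OF that]] that
      by (simp add: mult_semigroup_apply)
    ultimately have "norm (S r h (f r) - f r - h *\<^sub>R mult_op A f r) \<le> e * h"
      using h by (intro fibre.orbit_increment_le) auto
    then show "norm ((mult_semigroup h f - f - h *\<^sub>R mult_op A f) r) \<le> e * h"
      using h by (simp add: mult_semigroup_apply)
  qed
qed

end

section \<open>Ordered products\<close>

lemma prod_decreasing_Suc_left:
  "prod_decreasing V (Suc n) = V 1 o\<^sub>L prod_decreasing (\<lambda>p. V (Suc p)) n"
  by (induction n) (auto intro!: blinfun_eqI)

lemma prod_decreasing_cong:
  "(\<And>p. 1 \<le> p \<Longrightarrow> p \<le> n \<Longrightarrow> V p = V' p) \<Longrightarrow> prod_decreasing V n = prod_decreasing V' n"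
  by (induction n) auto

lemma prod_increasing_eq_decreasing:
  "prod_increasing V n = prod_decreasing (\<lambda>p. V (n - p)) n"
  by (induction n) (simp_all add: prod_decreasing_Suc_left del: prod_decreasing.simps(2))

lemma prod_increasing_grid:
  fixes s t :: real
  assumes "0 < n"
  shows "prod_increasing (\<lambda>p. G (s + real p * (t - s) / real n)) n
    = prod_decreasing (\<lambda>p. G (t - real p * ((t - s) / real n))) n"
  unfolding prod_increasing_eq_decreasing
proof (rule prod_decreasing_cong)
  fix p assume "1 \<le> p" "p \<le> n"
  then have "s + real (n - p) * (t - s) / real n = t - real p * ((t - s) / real n)"
    using assms by (simp add: of_nat_diff field_simps)
  then show "G (s + real (n - p) * (t - s) / real n) = G (t - real p * ((t - s) / real n))" by simp
qed

lemma blinfun_power_weighted_translation: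
  fixes V :: "'a::real_normed_vector c0 \<Rightarrow>\<^sub>L 'a c0" and L :: "real \<Rightarrow> 'a \<Rightarrow>\<^sub>L 'a"
  assumes V: "\<And>f s. V f s = L (s - h) (apply_c0 f (s - h))"
  shows "blinfun_power V n f s = prod_decreasing (\<lambda>p. L (s - real p * h)) n (f (s - real n * h))"
proof (induction n arbitrary: f)
  case (Suc n)
  have "s - real n * h - h = s - real (Suc n) * h" by (simp add: algebra_simps)
  with Suc[of "V f"] show ?case by (simp add: V del: of_nat_Suc)
qed simp

lemma norm_blinfun_power_weighted_translation_le:
  fixes V :: "'a::real_normed_vector c0 \<Rightarrow>\<^sub>L 'a c0" and L :: "real \<Rightarrow> 'a \<Rightarrow>\<^sub>L 'a"
  assumes V: "\<And>f s. V f s = L (s - h) (apply_c0 f (s - h))"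
    and L: "\<And>s. norm (prod_decreasing (\<lambda>p. L (s - real p * h)) n) \<le> K"
  shows "norm (blinfun_power V n) \<le> K"
proof -
  have "0 \<le> K" using L norm_ge_zero order_trans by blast
  then show ?thesis
    by (intro norm_blinfun_bound norm_c0_leI)
      (auto simp: blinfun_power_weighted_translation[OF V]
        intro!: order_trans[OF norm_blinfun mult_mono[OF L norm_apply_c0_le]])
qed

section \<open>The splitting formula\<close>

lemma difference_quotient_compose_tendsto:
  fixes V W :: "'i \<Rightarrow> 'a::real_normed_vector \<Rightarrow>\<^sub>L 'a"
  assumes bound: "\<forall>\<^sub>F i in F. norm (V i) \<le> K" and strong: "((\<lambda>i. V i b) \<longlongrightarrow> b) F"
    and V: "((\<lambda>i. (V i g - g) /\<^sub>R h i) \<longlongrightarrow> a) F" and W: "((\<lambda>i. (W i g - g) /\<^sub>R h i) \<longlongrightarrow> b) F"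
  shows "((\<lambda>i. ((V i o\<^sub>L W i) g - g) /\<^sub>R h i) \<longlongrightarrow> a + b) F"
proof -
  have "((\<lambda>i. (V i g - g) /\<^sub>R h i + V i ((W i g - g) /\<^sub>R h i)) \<longlongrightarrow> a + b) F"
    by (intro tendsto_add V tendsto_blinfun_apply_equibounded[OF bound strong W])
  then show ?thesis
    by (simp add: blinfun.scaleR_right blinfun.diff_right flip: scaleR_right_distrib)
qed

lemma c0_constant_on_bounded_set:
  fixes x :: "'a::real_normed_vector"
  shows "\<exists>f :: 'a c0. \<forall>s. \<bar>s\<bar> \<le> R \<longrightarrow> f s = x"
proof -
  let ?\<phi> = "\<lambda>s. max 0 (min 1 (R + 1 - \<bar>s\<bar>))"
  have "\<forall>\<^sub>F s in at_infinity. ?\<phi> s *\<^sub>R x = 0"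
    unfolding eventually_at_infinity by (intro exI[of _ "R + 1"]) auto
  then have "(\<lambda>s. ?\<phi> s *\<^sub>R x) \<in> C0"
    by (auto simp: C0_def tendsto_eventually intro!: continuous_intros)
  then show ?thesis
    by (intro exI[of _ "Abs_c0 (\<lambda>s. ?\<phi> s *\<^sub>R x)"]) (auto simp: apply_Abs_c0)
qed

lemma locally_uniform_limit_of_evolution_semigroup:
  fixes \<Phi> :: "nat \<Rightarrow> real \<Rightarrow> 'a::banach c0 \<Rightarrow> 'a c0"
  assumes U: "evolution_family U"
    and lim: "\<And>f \<tau>. uniform_limit {0..\<tau>} (\<lambda>n t. \<Phi> n t f) (\<lambda>t. evolution_semigroup U t f) sequentially"
    and \<Phi>: "\<And>n t s f. 0 < n \<Longrightarrow> s \<le> t \<Longrightarrow> \<Phi> n (t - s) f t = P n t s (f s)"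
    and Q: "compact Q" "Q \<subseteq> {(t, s). s \<le> t}"
  shows "uniform_limit Q (\<lambda>n (t, s). P n t s x) (\<lambda>(t, s). U t s x) sequentially"
proof (rule uniform_limitI)
  fix e :: real assume e: "0 < e"
  obtain R where R: "\<And>p. p \<in> Q \<Longrightarrow> norm p \<le> R"
    using compact_imp_bounded[OF Q(1)] by (auto simp: bounded_iff)
  obtain f :: "'a c0" where f: "\<And>s. \<bar>s\<bar> \<le> R \<Longrightarrow> f s = x"
    using c0_constant_on_bounded_set by blast
  have "\<forall>\<^sub>F n in sequentially. \<forall>t\<in>{0..2 * R}. dist (\<Phi> n t f) (evolution_semigroup U t f) < e"
    by (rule uniform_limitD[OF lim e])
  with eventually_gt_at_top[of "0::nat"]
  show "\<forall>\<^sub>F n in sequentially. \<forall>p\<in>Q.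
      dist (case p of (t, s) \<Rightarrow> P n t s x) (case p of (t, s) \<Rightarrow> U t s x) < e"
  proof eventually_elim
    case (elim n)
    have "dist (P n t s x) (U t s x) < e" if ts: "(t, s) \<in> Q" for t s
    proof -
      have bounds: "\<bar>t\<bar> \<le> R" "\<bar>s\<bar> \<le> R" "s \<le> t"
        using R[OF ts] norm_fst_le[of t s] norm_snd_le[of s t] Q(2) ts by auto
      have "norm ((\<Phi> n (t - s) f - evolution_semigroup U (t - s) f) t)
          \<le> dist (\<Phi> n (t - s) f) (evolution_semigroup U (t - s) f)"
        unfolding dist_norm by (rule norm_apply_c0_le)
      also have "\<dots> < e" using elim(2) bounds by auto
      finally show ?thesis
        using bounds elim(1) f by (simp add: \<Phi> evolution_semigroup_apply[OF U] dist_norm)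
    qed
    then show ?case by auto
  qed
qed

locale exponential_splitting =
  A: multiplication_semigroup DA A SA M w l + B: multiplication_semigroup DB B SB M w l
  for DA DB :: "real \<Rightarrow> 'a::banach set" and A B SA SB M w l
begin

definition splitting_step :: "real \<Rightarrow> 'a c0 \<Rightarrow>\<^sub>L 'a c0" where
  "splitting_step h = translation h o\<^sub>L (B.mult_semigroup h o\<^sub>L A.mult_semigroup h)"

lemma splitting_step_apply:
  "0 \<le> h \<Longrightarrow> splitting_step h f s = (SB (s - h) h o\<^sub>L SA (s - h) h) (f (s - h))"
  by (simp add: splitting_step_def translation_apply A.mult_semigroup_apply B.mult_semigroup_apply)

lemma splitting_step_quotient_tendsto:
  assumes "g \<in> deriv_dom \<inter> mult_dom DA A \<inter> mult_dom DB B"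
  shows "((\<lambda>h. (splitting_step h g - g) /\<^sub>R h)
    \<longlongrightarrow> - deriv_op g + mult_op A g + mult_op B g) (at_right 0)"
proof -
  interpret translation: exp_bounded_semigroup "translation :: real \<Rightarrow> 'a c0 \<Rightarrow>\<^sub>L 'a c0" 1 0
    by (rule translation_exp_bounded)
  have "((\<lambda>h. (splitting_step h g - g) /\<^sub>R h)
      \<longlongrightarrow> - deriv_op g + (mult_op B g + mult_op A g)) (at_right 0)" (is "(_ \<longlongrightarrow> ?y) _")
    unfolding splitting_step_def
  proof (intro difference_quotient_compose_tendsto translation.orbit_tendsto_at_right_zero
      B.mult.orbit_tendsto_at_right_zero)
    show "\<forall>\<^sub>F h in at_right 0. norm (translation h :: 'a c0 \<Rightarrow>\<^sub>L 'a c0) \<le> \<bar>1\<bar> * exp (\<bar>0\<bar> * 1)"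
      by (rule translation.eventually_norm_le_at_right_zero)
    show "\<forall>\<^sub>F h in at_right 0. norm (B.mult_semigroup h) \<le> \<bar>M\<bar> * exp (\<bar>w\<bar> * 1)"
      by (rule B.mult.eventually_norm_le_at_right_zero)
  qed (use assms deriv_op_in_translation_generator A.mult_op_in_generator B.mult_op_in_generator
      in \<open>auto simp: generator_graph_def\<close>)
  moreover have "?y = - deriv_op g + mult_op A g + mult_op B g" by simp
  ultimately show ?thesis by (simp only:)
qed

theorem splitting_formula:
  assumes W: "evolution_family W"
    and core: "generator_graph (evolution_semigroup W) \<subseteq>
      closure (op_graph (deriv_dom \<inter> mult_dom DA A \<inter> mult_dom DB B)
                        (\<lambda>f. - deriv_op f + mult_op A f + mult_op B f))"
    and stable: "\<And>h n s. 0 \<le> h \<Longrightarrow>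
      norm (prod_decreasing (\<lambda>p. SB (s - real p * h) h o\<^sub>L SA (s - real p * h) h) n)
      \<le> K * exp (\<omega> * (real n * h))"
    and Q: "compact Q" "Q \<subseteq> {(t, s). s \<le> t}"
  shows "uniform_limit Q
    (\<lambda>n (t, s). prod_increasing
      (\<lambda>p. SB (s + real p * (t - s) / real n) ((t - s) / real n) o\<^sub>L
           SA (s + real p * (t - s) / real n) ((t - s) / real n)) n x)
    (\<lambda>(t, s). W t s x) sequentially"
proof (rule locally_uniform_limit_of_evolution_semigroup[OF W _ _ Q])
  obtain M' w' where "\<And>t s. s \<le> t \<Longrightarrow> norm (W t s) \<le> M' * exp (w' * (t - s))"
    using W unfolding evolution_family_def by blast
  then interpret T: exp_bounded_semigroup "evolution_semigroup W" M' w'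
    by (rule evolution_semigroup_exp_bounded[OF W])
  show "uniform_limit {0..\<tau>} (\<lambda>n t. blinfun_power (splitting_step (t / real n)) n f)
      (\<lambda>t. evolution_semigroup W t f) sequentially" for f \<tau>
  proof (rule T.chernoff_product_formula[OF _ _ core splitting_step_quotient_tendsto])
    show "splitting_step 0 = id_blinfun"
      by (intro blinfun_eqI c0_eqI) (simp add: splitting_step_apply)
    show "norm (blinfun_power (splitting_step h) n) \<le> K * exp (\<omega> * (real n * h))" if "0 \<le> h" for h n
      by (rule norm_blinfun_power_weighted_translation_le[OF splitting_step_apply[OF that]
            stable[OF that]])
  qed
  fix n t s and f :: "'a c0"
  assume "0 < (n::nat)" "s \<le> (t::real)"
  then show "blinfun_power (splitting_step ((t - s) / real n)) n f t = prod_increasing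
      (\<lambda>p. SB (s + real p * (t - s) / real n) ((t - s) / real n) o\<^sub>L
           SA (s + real p * (t - s) / real n) ((t - s) / real n)) n (f s)"
    by (subst blinfun_power_weighted_translation[OF splitting_step_apply])
      (simp_all add: prod_increasing_grid[where
          G = "\<lambda>r. SB r ((t - s) / real n) o\<^sub>L SA r ((t - s) / real n)"])
qed

end

theorem theorem2p2:
  fixes DA DB :: "real \<Rightarrow> 'a::banach set"
    and A B :: "real \<Rightarrow> 'a \<Rightarrow> 'a"
    and W :: "real \<Rightarrow> real \<Rightarrow> 'a \<Rightarrow>\<^sub>L 'a"
    and SA SB :: "real \<Rightarrow> real \<Rightarrow> 'a \<Rightarrow>\<^sub>L 'a"
    and M \<omega> :: real
  assumes lin_A: "\<And>r. linear_operator (DA r) (A r)"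
    and lin_B: "\<And>r. linear_operator (DB r) (B r)"
    and wp: "well_posed (\<lambda>r. DA r \<inter> DB r) (\<lambda>r x. A r x + B r x)"
    and W_ev: "evolution_family W"
    and W_solves: "solves_NCP W (\<lambda>r. DA r \<inter> DB r) (\<lambda>r x. A r x + B r x)"
    and W_gen: "generator_graph (evolution_semigroup W) =
      closure (op_graph (deriv_dom \<inter> mult_dom DA A \<inter> mult_dom DB B)
                        (\<lambda>f. - deriv_op f + mult_op A f + mult_op B f))"
    and M: "1 \<le> M"
    and gen_A: "\<And>r. generates (DA r) (A r) (SA r)"
    and gen_B: "\<And>r. generates (DB r) (B r) (SB r)"
    and bound_A: "\<And>r t. 0 \<le> t \<Longrightarrow> norm (SA r t) \<le> M * exp (\<omega> * t)"
    and bound_B: "\<And>r t. 0 \<le> t \<Longrightarrow> norm (SB r t) \<le> M * exp (\<omega> * t)"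
    and stable: "\<And>t n s. 0 \<le> t \<Longrightarrow> 1 \<le> n \<Longrightarrow>
      norm (prod_decreasing
        (\<lambda>p. SB (s - real p * t / real n) (t / real n) o\<^sub>L SA (s - real p * t / real n) (t / real n)) n)
      \<le> M * exp (\<omega> * t)"
    and cont_A: "\<And>\<mu> x. \<omega> < \<mu> \<Longrightarrow> continuous_on UNIV (\<lambda>t. resolvent \<mu> (DA t) (A t) x)"
    and cont_B: "\<And>\<mu> x. \<omega> < \<mu> \<Longrightarrow> continuous_on UNIV (\<lambda>t. resolvent \<mu> (DB t) (B t) x)"
  shows "\<forall>x. \<forall>K. compact K \<and> K \<subseteq> {(t, s). s \<le> t} \<longrightarrow>
    uniform_limit K
      (\<lambda>n (t, s). prod_increasing
        (\<lambda>p. SB (s + real p * (t - s) / real n) ((t - s) / real n) o\<^sub>L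
             SA (s + real p * (t - s) / real n) ((t - s) / real n)) n x)
      (\<lambda>(t, s). W t s x) sequentially"
proof -
  interpret exponential_splitting DA DB A B SA SB M \<omega> "\<omega> + 1"
    using gen_A gen_B bound_A bound_B cont_A cont_B by unfold_locales auto
  have "norm (prod_decreasing (\<lambda>p. SB (s - real p * h) h o\<^sub>L SA (s - real p * h) h) n)
      \<le> M * exp (\<omega> * (real n * h))" if "0 \<le> h" for h n s
  proof (cases "n = 0")
    case True
    then show ?thesis using M norm_blinfun_id_le[where 'a = 'a] by simp
  next
    case False
    then show ?thesis using stable[of "real n * h" n s] that by simp
  qed
  then show ?thesis
    using splitting_formula[OF W_ev equalityD1[OF W_gen]] by blast
qed

end
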